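(* Fix $0 \leq \alpha < n$, and let $p(\cdot) \in \mathcal{P}(\mathbb{R}^n)$ satisfy $p_+\le\frac{n}{\alpha}$. Define $q(\cdot) \in \mathcal{P}(\mathbb{R}^n)$ by $\frac{1}{p(x)} - \frac{1}{q(x)} = \frac{\alpha}{n}$, $x\in\mathbb{R}^n$. Let $T_\alpha$ be a fractional Calderón-Zygmund operator with a non-degenerate kernel. If $T_\alpha : L^{p(\cdot)}(\mathbb{R}^n) \to L^{q(\cdot)}(\mathbb{R}^n)$, then $1 < p_- \leq p_+ < \frac{n}{\alpha}$.
   Context: Conventions: $1/\infty = 0$, and $n/\alpha=\infty$ when $\alpha=0$. $\mathcal{P}(\mathbb{R}^n)$ is the set of Lebesgue measurable functions $p(\cdot):\mathbb{R}^n\to[1,\infty]$ (exponent functions); $p_-=\operatorname{ess\,inf}_{x\in\mathbb{R}^n} p(x)$, $p_+=\operatorname{ess\,sup}_{x\in\mathbb{R}^n} p(x)$. Modular: with $\Omega_\infty=\{x\in\mathbb{R}^n: p(x)=\infty\}$, $\rho_{p(\cdot)}(f)=\int_{\mathbb{R}^n\setminus\Omega_\infty}|f(x)|^{p(x)}\,dx+\|f\|_{L^\infty(\Omega_\infty)}$. Norm: $\|f\|_{p(\cdot)}=\inf\{\lambda>0:\rho_{p(\cdot)}(f/\lambda)\le 1\}$. $L^{p(\cdot)}(\mathbb{R}^n)$ is the set of measurable $f$ with $\rho_{p(\cdot)}(f/\lambda)<\infty$ for some $\lambda>0$. Fractional Calderón-Zygmund operator: an operator $T_\alpha$, defined on measurable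 functions, that is bounded from $L^p(\mathbb{R}^n)$ to $L^q(\mathbb{R}^n)$ for some fixed $1<p\le q<\infty$ and such that for any $f\in L^p(\mathbb{R}^n)$ with compact support, $T_\alpha f(x)=\int_{\mathbb{R}^n}K_\alpha(x,y)f(y)\,dy$ for $x\notin\operatorname{supp}(f)$. Here the kernel $K_\alpha(x,y)$ is defined for all $(x,y)\in\mathbb{R}^n\times\mathbb{R}^n$, $x\ne y$, and for some constants $C_0$ and $\delta>0$ satisfies the size estimate $|K_\alpha(x,y)|\le \frac{C_0}{|x-y|^{n-\alpha}}$ and the smoothness estimate $|K_\alpha(x+h,y)-K_\alpha(x,y)|+|K_\alpha(x,y+h)-K_\alpha(x,y)|\le C_0\frac{|h|^\delta}{|x-y|^{n-\alpha+\delta}}$ for all $|h|<\frac12|x-y|$. Non-degenerate kernel: there exist $a>0$ and a unit vector $u_1$ such that $|K_\alpha(x,y)|\ge\frac{a}{|x-y|^{n-\alpha}}$ for all $x\neq y$ in $\mathbb{R}^n$ with $x-y=tu_1$ for some $t\in\mathbb{R}$. For an operator $T$, $T:L^{p(\cdot)}(\mathbb{R}^n)\to L^{q(\cdot)}(\mathbb{R}^n)$ means that there is a constant $C$ with $\|Tf\|_{q(\cdot)}\le C\|f\|_{p(\cdot)}$ for all $f\in L^{p(\cdot)}(\mathbb{R}^n)$. *)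

theory Defs
  imports "HOL-Analysis.Analysis" "HOL-Probability.Essential_Supremum"
begin

text \<open>
  Exponents are \<open>ereal\<close>-valued, so that differences such as \<open>1 / p x - 1 / q x\<close> are genuine
  (not truncated). In \<open>ereal\<close> one has \<open>1 / \<infinity> = 0\<close> and \<open>n / 0 = \<infinity>\<close> for \<open>n > 0\<close>.
  The scalar field is a type \<open>'k :: {real_normed_field, euclidean_space}\<close>, which covers
  both real-valued and complex-valued functions and kernels.
\<close>

definition exponent_function :: "(real^'n \<Rightarrow> ereal) \<Rightarrow> bool" where
  "exponent_function p \<longleftrightarrow> p \<in> borel_measurable lebesgue \<and> (\<forall>x. 1 \<le> p x)"

definition p_minus :: "(real^'n \<Rightarrow> ereal) \<Rightarrow> ereal" where
  "p_minus p = Sup {c. AE x in lebesgue. c \<le> p x}"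

definition p_plus :: "(real^'n \<Rightarrow> ereal) \<Rightarrow> ereal" where
  "p_plus p = esssup lebesgue p"

definition Omega_inf :: "(real^'n \<Rightarrow> ereal) \<Rightarrow> (real^'n) set" where
  "Omega_inf p = {x. p x = \<infinity>}"

text \<open>
  The supremum norm is taken in \<open>ennreal\<close>, so it is \<open>0\<close> when \<open>Omega_inf p\<close> is a null set.
\<close>

definition modular :: "(real^'n \<Rightarrow> ereal) \<Rightarrow> (real^'n \<Rightarrow> 'k::{real_normed_field,euclidean_space}) \<Rightarrow> ennreal" where
  "modular p f =
     (\<integral>\<^sup>+ x \<in> - Omega_inf p. ennreal (norm (f x) powr real_of_ereal (p x)) \<partial>lebesgue)
     + esssup (restrict_space lebesgue (Omega_inf p)) (\<lambda>x. ennreal (norm (f x)))"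

definition var_norm :: "(real^'n \<Rightarrow> ereal) \<Rightarrow> (real^'n \<Rightarrow> 'k::{real_normed_field,euclidean_space}) \<Rightarrow> ennreal" where
  "var_norm p f = Inf {ennreal c | c. c > 0 \<and> modular p (\<lambda>x. f x /\<^sub>R c) \<le> 1}"

definition var_Lp :: "(real^'n \<Rightarrow> ereal) \<Rightarrow> (real^'n \<Rightarrow> 'k::{real_normed_field,euclidean_space}) set" where
  "var_Lp p = {f \<in> borel_measurable lebesgue. \<exists>c>0. modular p (\<lambda>x. f x /\<^sub>R c) < \<infinity>}"

text \<open>
  Membership \<open>T f \<in> var_Lp q\<close> says no more than that \<open>T f\<close> is measurable: its norm is finite
  by the inequality.
\<close>

definition bounded_var_Lp ::
  "(real^'n \<Rightarrow> ereal) \<Rightarrow> (real^'n \<Rightarrow> ereal) \<Rightarrow>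
   ((real^'n \<Rightarrow> 'k) \<Rightarrow> (real^'n \<Rightarrow> 'k::{real_normed_field,euclidean_space})) \<Rightarrow> bool" where
  "bounded_var_Lp p q T \<longleftrightarrow>
     (\<exists>C::real. \<forall>f\<in>var_Lp p. T f \<in> var_Lp q \<and> var_norm q (T f) \<le> ennreal C * var_norm p f)"

text \<open>The classical Lebesgue spaces, for finite constant exponents.\<close>

definition Lp_space :: "real \<Rightarrow> (real^'n \<Rightarrow> 'k::{real_normed_field,euclidean_space}) set" where
  "Lp_space r = {f \<in> borel_measurable lebesgue. integrable lebesgue (\<lambda>x. norm (f x) powr r)}"

definition Lp_norm :: "real \<Rightarrow> (real^'n \<Rightarrow> 'k::{real_normed_field,euclidean_space}) \<Rightarrow> real" where
  "Lp_norm r f = (\<integral>x. norm (f x) powr r \<partial>lebesgue) powr (1 / r)"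

definition bounded_Lp ::
  "real \<Rightarrow> real \<Rightarrow> ((real^'n \<Rightarrow> 'k) \<Rightarrow> (real^'n \<Rightarrow> 'k::{real_normed_field,euclidean_space})) \<Rightarrow> bool" where
  "bounded_Lp r s T \<longleftrightarrow>
     (\<exists>C::real. \<forall>f\<in>Lp_space r. T f \<in> Lp_space s \<and> Lp_norm s (T f) \<le> C * Lp_norm r f)"

definition fun_supp :: "(real^'n \<Rightarrow> 'k::zero) \<Rightarrow> (real^'n) set" where
  "fun_supp f = closure {x. f x \<noteq> 0}"

text \<open>Kernels are total functions; their values on the diagonal are unconstrained.\<close>

definition fractional_CZ_kernel ::
  "real \<Rightarrow> (real^'n \<Rightarrow> real^'n \<Rightarrow> 'k::{real_normed_field,euclidean_space}) \<Rightarrow> bool" where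
  "fractional_CZ_kernel \<alpha> K \<longleftrightarrow>
     (\<exists>C0 \<delta>::real. \<delta> > 0 \<and>
        (\<forall>x y. x \<noteq> y \<longrightarrow> norm (K x y) \<le> C0 / norm (x - y) powr (real CARD('n) - \<alpha>)) \<and>
        (\<forall>x y h. x \<noteq> y \<longrightarrow> norm h < norm (x - y) / 2 \<longrightarrow>
           norm (K (x + h) y - K x y) + norm (K x (y + h) - K x y)
             \<le> C0 * norm h powr \<delta> / norm (x - y) powr (real CARD('n) - \<alpha> + \<delta>)))"

text \<open>
  The integral representation is required almost everywhere off the support, since \<open>T f\<close> is
  an element of a Lebesgue space; this includes operators for which it holds at every point.
\<close>

definition fractional_CZ_operator ::
  "real \<Rightarrow> (real^'n \<Rightarrow> real^'n \<Rightarrow> 'k) \<Rightarrow>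
   ((real^'n \<Rightarrow> 'k) \<Rightarrow> (real^'n \<Rightarrow> 'k::{real_normed_field,euclidean_space})) \<Rightarrow> bool" where
  "fractional_CZ_operator \<alpha> K T \<longleftrightarrow>
     fractional_CZ_kernel \<alpha> K \<and>
     (\<exists>r s::real. 1 < r \<and> r \<le> s \<and> bounded_Lp r s T \<and>
        (\<forall>f\<in>Lp_space r. compact (fun_supp f) \<longrightarrow>
           (AE x in lebesgue. x \<notin> fun_supp f \<longrightarrow> T f x = (\<integral>y. K x y * f y \<partial>lebesgue))))"

definition nondegenerate_kernel ::
  "real \<Rightarrow> (real^'n \<Rightarrow> real^'n \<Rightarrow> 'k::{real_normed_field,euclidean_space}) \<Rightarrow> bool" where
  "nondegenerate_kernel \<alpha> K \<longleftrightarrow>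
     (\<exists>a>0. \<exists>u. norm u = 1 \<and>
        (\<forall>x y. x \<noteq> y \<longrightarrow> (\<exists>t. x - y = t *\<^sub>R u) \<longrightarrow>
           norm (K x y) \<ge> a / norm (x - y) powr (real CARD('n) - \<alpha>)))"

end

theory Submission
  imports Defs
begin

text \<open>
  Only values of \<open>T f\<close> away from the support of \<open>f\<close> can be estimated, and \<open>T\<close> is not assumed linear,
  so both bounds come from testing the norm inequality on step functions and evaluating the
  kernel integral at points outside their support. In a cone around the line spanned by the
  non-degeneracy direction, smoothness makes \<open>K\<close> nearly constant on pairs of balls of radius
  comparable to \<open>\<rho>\<close> at distance comparable to \<open>\<rho>\<close>, with modulus at least a multiple of \<open>\<rho> powr (\<alpha> - n)\<close>
  (\<open>kernel_size_on_cones\<close>).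

  If \<open>p\<close> comes arbitrarily close to \<open>1\<close>, a bump at scale \<open>r\<close> is mapped to a function of size
  \<open>\<rho> powr (\<alpha> - n)\<close> at distance \<open>\<rho>\<close>; for exponent exactly \<open>1\<close> every dyadic scale \<open>\<rho> = r * 2 ^ j\<close> contributes
  the same amount to the modular for \<open>q\<close>, so \<open>N\<close> scales contradict boundedness for large \<open>N\<close>. If \<open>p\<close> comes
  arbitrarily close to \<open>n / \<alpha>\<close>, the situation is dual: a function of size \<open>\<rho> powr (- \<alpha>)\<close> on \<open>N\<close> scales has
  norm of order \<open>N powr (\<alpha> / n)\<close>, whereas the contributions of the scales add up to \<open>N\<close> at the centre.

  The difficulty is that the exponent varies. The set where \<open>p\<close> is within \<open>\<epsilon>\<close> of the critical value has
  points of density, but the radius \<open>r\<close> at which the density is felt depends on \<open>\<epsilon>\<close>, so that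
  \<open>r powr \<epsilon>\<close> is out of control and the norms of balls at different places cannot be compared. What saves
  the argument is monotonicity: with \<open>s\<close> the distance of \<open>1 / p\<close> from its critical value, the central cube
  contributes a factor \<open>r powr (n * s)\<close> and the distant cubes contribute factors \<open>r powr (- (n * s))\<close>. Their product is
  bounded below as soon as \<open>s\<close> is at least as large on the distant cubes as on the central one. On a grid of small
  cubes, compare the medians of \<open>s\<close>. For a pair of cubes one of the two orderings always holds, and the cone is available in both directions \<open>u\<close>
  and \<open>- u\<close>; averaging over all pairs yields one cube that is ordered correctly with respect to a fixed
  fraction of the cubes on \<open>N\<close> scales (\<open>half_of_pairs_ascend\<close>, \<open>monotone_cluster_family\<close>). All
  constants are then independent of \<open>\<epsilon>\<close> and \<open>r\<close>, and \<open>N\<close> can tend to infinity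
  (\<open>one_less_p_minus\<close>, \<open>p_plus_less\<close>).
\<close>

section \<open>Cubes in which a set of positive measure is dense\<close>

text \<open>
  The cells are half-open so that, for fixed \<open>r\<close>, they partition the space exactly.
\<close>

definition grid_cell :: "real \<Rightarrow> ('n::finite \<Rightarrow> int) \<Rightarrow> (real^'n) set" where
  "grid_cell r i = {x. \<forall>b. r * of_int (i b) \<le> x $ b \<and> x $ b < r * (of_int (i b) + 1)}"

lemma grid_cell_bounds:
  "box (\<chi> b. r * of_int (i b)) (\<chi> b. r * (of_int (i b) + 1)) \<subseteq> grid_cell r i"
  "grid_cell r i \<subseteq> cbox (\<chi> b. r * of_int (i b)) (\<chi> b. r * (of_int (i b) + 1))"
  unfolding grid_cell_def by (auto simp: mem_box_cart less_imp_le)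

lemma grid_cell_borel [measurable]: "grid_cell r i \<in> sets borel"
  unfolding grid_cell_def by measurable

lemma grid_cell_measure:
  fixes i :: "'n::finite \<Rightarrow> int"
  assumes "0 < r"
  shows "grid_cell r i \<in> lmeasurable" "measure lebesgue (grid_cell r i) = r ^ CARD('n)"
proof -
  define a c :: "real^'n" where "a = (\<chi> b. r * of_int (i b))" and "c = (\<chi> b. r * (of_int (i b) + 1))"
  have sub: "box a c \<subseteq> grid_cell r i" "grid_cell r i \<subseteq> cbox a c"
    using grid_cell_bounds[of r i] by (simp_all add: a_def c_def)
  have l: "grid_cell r i \<in> sets lebesgue"
    using grid_cell_borel[of r i] by auto
  show m: "grid_cell r i \<in> lmeasurable"
    by (rule lmeasurable_cbox[of a c, THEN fmeasurableI2]) (use sub l in auto)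
  have ne: "cbox a c \<noteq> {}"
    using assms by (simp add: a_def c_def interval_ne_empty_cart algebra_simps)
  have cm: "measure lebesgue (cbox a c) = r ^ CARD('n)"
    using content_cbox_cart[OF ne] by (simp add: a_def c_def algebra_simps)
  have "measure lebesgue (box a c) = measure lebesgue (cbox a c)"
    using ne by (simp add: measure_lborel_box_eq measure_lborel_cbox_eq)
  moreover have "measure lebesgue (box a c) \<le> measure lebesgue (grid_cell r i)"
    by (rule measure_mono_fmeasurable) (use sub m in auto)
  moreover have "measure lebesgue (grid_cell r i) \<le> measure lebesgue (cbox a c)"
    by (rule measure_mono_fmeasurable) (use sub l in auto)
  ultimately show "measure lebesgue (grid_cell r i) = r ^ CARD('n)" using cm by simp
qed

lemma grid_cell_disjoint:
  assumes "0 < r" "x \<in> grid_cell r i" "x \<in> grid_cell r j"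
  shows "i = j"
proof
  fix b
  have "r * of_int (i b) < r * (of_int (j b) + 1)" "r * of_int (j b) < r * (of_int (i b) + 1)"
    using assms(2,3) unfolding grid_cell_def by (auto intro: le_less_trans)
  then have "real_of_int (i b) < of_int (j b) + 1" "real_of_int (j b) < of_int (i b) + 1"
    using assms(1) by simp_all
  then show "i b = j b" by linarith
qed

lemma grid_cell_index:
  assumes "0 < r"
  shows "x \<in> grid_cell r (\<lambda>b. \<lfloor>x $ b / r\<rfloor>)"
proof -
  have "r * of_int \<lfloor>y / r\<rfloor> \<le> y \<and> y < r * (of_int \<lfloor>y / r\<rfloor> + 1)" for y
  proof -
    have "of_int \<lfloor>y / r\<rfloor> \<le> y / r" "y / r < of_int \<lfloor>y / r\<rfloor> + 1" by linarith+
    then show ?thesis using assms by (simp only: pos_le_divide_eq pos_divide_less_eq mult.commute)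
  qed
  then show ?thesis by (simp add: grid_cell_def)
qed

lemma grid_cell_subset_cball:
  fixes i :: "'n::finite \<Rightarrow> int"
  shows "grid_cell r i \<subseteq> cball (\<chi> b. r * of_int (i b)) (real CARD('n) * r)"
proof
  fix x assume x: "x \<in> grid_cell r i"
  have "norm (x - (\<chi> b. r * of_int (i b))) \<le> (\<Sum>b\<in>UNIV. \<bar>(x - (\<chi> b. r * of_int (i b))) $ b\<bar>)"
    by (rule norm_le_l1_cart)
  also have "\<dots> \<le> (\<Sum>b\<in>(UNIV::'n set). r)"
    using x by (intro sum_mono) (auto simp: grid_cell_def algebra_simps abs_le_iff less_imp_le)
  finally show "x \<in> cball (\<chi> b. r * of_int (i b)) (real CARD('n) * r)"
    by (simp add: dist_norm norm_minus_commute)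
qed

lemma compact_positive_subset:
  fixes E :: "'a::euclidean_space set"
  assumes E: "E \<in> sets lebesgue" and pos: "emeasure lebesgue E \<noteq> 0"
  obtains C where "compact C" "C \<subseteq> E" "0 < measure lebesgue C"
proof -
  have "\<exists>k::nat. emeasure lebesgue (E \<inter> cball 0 k) \<noteq> 0"
  proof (rule ccontr)
    assume "\<not> ?thesis"
    then have "(\<Union>k::nat. E \<inter> cball 0 k) \<in> null_sets lebesgue"
      using E by (intro null_sets_UN) (auto simp: null_sets_def simp del: emeasure_completion)
    moreover have "(\<Union>k::nat. E \<inter> cball 0 k) = E"
      using real_arch_simple by auto
    ultimately show False using pos by auto
  qed
  then obtain k :: nat where k: "emeasure lebesgue (E \<inter> cball 0 k) \<noteq> 0" by blast
  define F where "F = E \<inter> cball 0 (real k)"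
  have F: "F \<in> lmeasurable" unfolding F_def using E
    by (intro fmeasurableI2[OF lmeasurable_cball[of 0 "real k"]]) auto
  have mF: "0 < measure lebesgue F"
    using k F by (simp add: F_def emeasure_eq_measure2 zero_less_measure_iff)
  obtain C where C: "closed C" "C \<subseteq> F" "F - C \<in> lmeasurable" "emeasure lebesgue (F - C) < ennreal (measure lebesgue F)"
    using sets_lebesgue_inner_closed[OF fmeasurableD[OF F] mF] by blast
  have cC: "compact C"
    using C by (auto simp: compact_eq_bounded_closed F_def intro: bounded_subset[OF bounded_cball])
  then have Cm: "C \<in> lmeasurable" by (simp add: lmeasurable_compact)
  have "measure lebesgue (F - C) = measure lebesgue F - measure lebesgue C"
    using C F Cm by (intro measurable_measure_Diff) auto
  moreover have "measure lebesgue (F - C) < measure lebesgue F"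
    using C(3,4) mF by (simp add: emeasure_eq_measure2 ennreal_less_iff)
  ultimately show thesis using that[OF cC] C(2) F_def by auto
qed

text \<open>
  A density theorem for cubes: cover a compact piece \<open>C\<close> of \<open>E\<close> by the fine grid cells meeting it. They lie in
  an open set that is hardly larger than \<open>C\<close>, so their total excess over \<open>C\<close> is small, and by averaging some cell has
  small relative excess.
\<close>

lemma dense_grid_cell:
  fixes E :: "(real^'n::finite) set"
  assumes E: "E \<in> sets lebesgue" "emeasure lebesgue E \<noteq> 0" and "0 < \<eta>" "0 < R0"
  obtains R i where "0 < R" "R < R0"
    "measure lebesgue (grid_cell R i - E) < \<eta> * R ^ CARD('n)"
proof -
  obtain C where C: "compact C" "C \<subseteq> E" "0 < measure lebesgue C"
    using compact_positive_subset[OF E] by blast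
  have Cm: "C \<in> lmeasurable" using C by (simp add: lmeasurable_compact)
  obtain U where U: "open U" "C \<subseteq> U" "U - C \<in> lmeasurable"
      "emeasure lebesgue (U - C) < ennreal (\<eta> * measure lebesgue C)"
    using sets_lebesgue_outer_open[OF fmeasurableD[OF Cm], of "\<eta> * measure lebesgue C"] C \<open>0 < \<eta>\<close> by auto
  have mU: "measure lebesgue (U - C) < \<eta> * measure lebesgue C"
    using U(3,4) C \<open>0 < \<eta>\<close> by (simp add: emeasure_eq_measure2 ennreal_less_iff)
  obtain d where d: "d > 0" "\<And>x y. x \<in> C \<Longrightarrow> y \<in> - U \<Longrightarrow> d \<le> dist x y"
    using separate_compact_closed[of C "- U"] C(1) U(1,2)
    by (metis closed_Compl disjoint_eq_subset_Compl double_compl)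
  define R where "R = min (R0 / 2) (d / (4 * real CARD('n)))"
  have R: "0 < R" "R < R0" using d \<open>0 < R0\<close> by (auto simp: R_def)
  have "R \<le> d / (4 * real CARD('n))" by (simp add: R_def)
  then have dR: "2 * (real CARD('n) * R) < d" using d by (simp add: field_simps)
  define I where "I = {i. grid_cell R i \<inter> C \<noteq> {}}"
  obtain M where M: "\<And>x. x \<in> C \<Longrightarrow> norm x \<le> M"
    using C(1) by (meson bounded_iff compact_imp_bounded)
  have finI: "finite I"
  proof (rule finite_subset)
    show "I \<subseteq> PiE UNIV (\<lambda>_. {\<lfloor>- M / R\<rfloor> - 1 .. \<lfloor>M / R\<rfloor>})"
    proof
      fix i assume "i \<in> I"
      then obtain x where x: "x \<in> grid_cell R i" "x \<in> C" by (auto simp: I_def)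
      have "i b \<in> {\<lfloor>- M / R\<rfloor> - 1 .. \<lfloor>M / R\<rfloor>}" for b
      proof -
        have "\<bar>x $ b\<bar> \<le> M" using M[OF x(2)] component_le_norm_cart[of x b] by linarith
        moreover have "R * of_int (i b) \<le> x $ b" "x $ b < R * (of_int (i b) + 1)"
          using x(1) by (auto simp: grid_cell_def)
        ultimately have "R * of_int (i b) \<le> M" "- M < R * (of_int (i b) + 1)" by linarith+
        then have "of_int (i b) \<le> M / R" "- M / R < of_int (i b) + 1"
          using R by (simp_all add: field_simps)
        then show ?thesis by (auto simp: le_floor_iff) linarith
      qed
      then show "i \<in> PiE UNIV (\<lambda>_. {\<lfloor>- M / R\<rfloor> - 1 .. \<lfloor>M / R\<rfloor>})" by auto
    qed
  qed (auto intro!: finite_PiE)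
  have cover: "C \<subseteq> (\<Union>i\<in>I. grid_cell R i)"
    using grid_cell_index[OF R(1)] by (auto simp: I_def)
  have inU: "(\<Union>i\<in>I. grid_cell R i) \<subseteq> U"
  proof clarify
    fix i x assume "i \<in> I" and x: "x \<in> grid_cell R i"
    then obtain y where y: "y \<in> grid_cell R i" "y \<in> C" by (auto simp: I_def)
    have "dist y x \<le> 2 * (real CARD('n) * R)"
      using subsetD[OF grid_cell_subset_cball x] subsetD[OF grid_cell_subset_cball y(1)]
      by (metis dist_commute dist_triangle_le mem_cball add_mono mult_2)
    then show "x \<in> U" using d(2)[OF y(2), of x] dR by fastforce
  qed
  have cm: "grid_cell R i \<in> lmeasurable" for i :: "'n \<Rightarrow> int" using grid_cell_measure[OF R(1)] by blast
  have dm: "grid_cell R i - C \<in> lmeasurable" for i :: "'n \<Rightarrow> int" using cm Cm by auto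
  have disj: "disjoint_family_on (grid_cell R) I"
    using grid_cell_disjoint[OF R(1)] by (auto simp: disjoint_family_on_def)
  have disj2: "disjoint_family_on (\<lambda>i. grid_cell R i - C) I"
    using disj by (auto simp: disjoint_family_on_def)
  have "(\<Sum>i\<in>I. measure lebesgue (grid_cell R i - C)) = measure lebesgue (\<Union>i\<in>I. grid_cell R i - C)"
    using finI disj2 dm by (intro measure_UNION'[symmetric]) (auto simp: pairwise_def disjnt_def disjoint_family_on_def)
  also have "\<dots> \<le> measure lebesgue (U - C)"
  proof (rule measure_mono_fmeasurable)
    show "(\<Union>i\<in>I. grid_cell R i - C) \<in> sets lebesgue"
      using finI dm by (intro sets.finite_UN fmeasurableD)
  qed (use inU U(3) in auto)
  also have "\<dots> < \<eta> * measure lebesgue C" by (fact mU)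
  also have "\<dots> \<le> \<eta> * measure lebesgue (\<Union>i\<in>I. grid_cell R i)"
    using \<open>0 < \<eta>\<close> cover Cm cm finI
    by (intro mult_left_mono measure_mono_fmeasurable fmeasurable.finite_UN) auto
  also have "measure lebesgue (\<Union>i\<in>I. grid_cell R i) = (\<Sum>i\<in>I. measure lebesgue (grid_cell R i))"
    using finI disj cm by (intro measure_UNION') (auto simp: pairwise_def disjnt_def disjoint_family_on_def)
  also have "\<eta> * \<dots> = (\<Sum>i\<in>I. \<eta> * R ^ CARD('n))"
    using grid_cell_measure[OF R(1), where 'n='n] by (simp add: sum_distrib_left)
  finally obtain i where i: "i \<in> I" "measure lebesgue (grid_cell R i - C) < \<eta> * R ^ CARD('n)"
    by (meson not_le sum_mono)
  have "measure lebesgue (grid_cell R i - E) \<le> measure lebesgue (grid_cell R i - C)"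
    using C(2) E(1) dm fmeasurableD[OF cm] by (intro measure_mono_fmeasurable) auto
  then have "measure lebesgue (grid_cell R i - E) < \<eta> * R ^ CARD('n)" using i(2) by linarith
  then show thesis by (rule that[OF R])
qed

section \<open>Medians and ordered pairs of grid points\<close>

text \<open>
  The median is the infimum of the levels whose sublevel set has at least half of the measure; continuity of
  the measure along decreasing and increasing sets transfers this to both inequalities at the median itself.
\<close>

lemma median_split:
  fixes s :: "'a \<Rightarrow> real"
  assumes A: "A \<in> fmeasurable M" "0 < measure M A"
    and s: "s \<in> borel_measurable M" and bd: "\<And>x. x \<in> A \<Longrightarrow> 0 \<le> s x \<and> s x \<le> \<epsilon>"
  obtains m where "0 \<le> m" "m \<le> \<epsilon>"
    "measure M A / 2 \<le> measure M {x \<in> A. s x \<le> m}"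
    "measure M A / 2 \<le> measure M {x \<in> A. m \<le> s x}"
proof -
  have As: "A \<in> sets M" using A by auto
  have Asp: "x \<in> A \<Longrightarrow> x \<in> space M" for x using sets.sets_into_space[OF As] by blast
  have sub: "{x \<in> A. P (s x)} \<in> sets M" if "Measurable.pred borel P" for P
  proof -
    have "{x \<in> A. P (s x)} = A \<inter> {x \<in> space M. P (s x)}" using Asp by auto
    moreover have "{x \<in> space M. P (s x)} \<in> sets M" using s that by measurable
    ultimately show ?thesis using As by auto
  qed
  have fin: "B \<subseteq> A \<Longrightarrow> emeasure M B \<noteq> \<infinity>" for B
    using A(1) emeasure_mono[of B A M] As by (auto simp: fmeasurable_def top_unique)
  have fm: "{x \<in> A. P (s x)} \<in> fmeasurable M" if "Measurable.pred borel P" for P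
    using sub[OF that] by (intro fmeasurableI2[OF A(1)]) auto
  define S where "S = {t. measure M A / 2 \<le> measure M {x \<in> A. s x \<le> t}}"
  have up: "\<epsilon> \<in> S"
  proof -
    have "{x \<in> A. s x \<le> \<epsilon>} = A" using bd by auto
    then show ?thesis using A(2) by (simp add: S_def)
  qed
  have nonneg: "0 \<le> t" if "t \<in> S" for t
  proof (rule ccontr)
    assume "\<not> 0 \<le> t"
    then have "{x \<in> A. s x \<le> t} = {}" using bd by force
    then have "measure M A / 2 \<le> measure M {}" using that by (simp only: S_def mem_Collect_eq)
    then show False using A(2) by simp
  qed
  have mono: "t' \<in> S" if "t \<in> S" "t \<le> t'" for t t'
  proof -
    have "measure M {x \<in> A. s x \<le> t} \<le> measure M {x \<in> A. s x \<le> t'}"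
      using that(2) by (intro measure_mono_fmeasurable fm sub) auto
    then show ?thesis using that(1) by (simp add: S_def)
  qed
  define m where "m = Inf S"
  have bdd: "bdd_below S" using nonneg by (rule bdd_belowI)
  have m: "0 \<le> m" "m \<le> \<epsilon>"
    unfolding m_def using up nonneg bdd by (auto intro: cInf_greatest cInf_lower)
  have above: "t \<in> S" if "m < t" for t
    using that cInf_less_iff[of S t] up bdd mono[of _ t] unfolding m_def by (auto intro: less_imp_le)
  have below: "t \<notin> S" if "t < m" for t
    using that cInf_lower[OF _ bdd, of t] unfolding m_def by auto
  have le_half: "measure M A / 2 \<le> measure M {x \<in> A. s x \<le> m}"
  proof -
    define F where "F k = {x \<in> A. s x \<le> m + 1 / real (Suc k)}" for k
    have "(\<lambda>k. measure M (F k)) \<longlonglongrightarrow> measure M (\<Inter>k. F k)"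
    proof (rule Lim_measure_decseq)
      show "range F \<subseteq> sets M" unfolding F_def by (auto intro!: sub)
      show "decseq F" unfolding F_def decseq_def
        by (auto intro: order.trans simp: frac_le)
      show "emeasure M (F k) \<noteq> \<infinity>" for k by (rule fin) (auto simp: F_def)
    qed
    moreover have "(\<Inter>k. F k) = {x \<in> A. s x \<le> m}"
    proof (intro set_eqI iffI)
      fix x assume "x \<in> (\<Inter>k. F k)"
      then have x: "x \<in> A" "s x \<le> m + 1 / real (Suc k)" for k by (simp_all add: F_def)
      have "s x \<le> m"
      proof (rule field_le_epsilon)
        fix e :: real assume "0 < e"
        then obtain k where "1 / real (Suc k) < e" using nat_approx_posE by blast
        then show "s x \<le> m + e" using x(2)[of k] by linarith
      qed
      then show "x \<in> {x \<in> A. s x \<le> m}" using x by simp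
    next
      fix x assume x: "x \<in> {x \<in> A. s x \<le> m}"
      have "s x \<le> m + 1 / real (Suc k)" for k
      proof -
        have "0 \<le> 1 / real (Suc k)" "s x \<le> m" using x by simp_all
        then show ?thesis by linarith
      qed
      then show "x \<in> (\<Inter>k. F k)" using x by (simp add: F_def)
    qed
    moreover have "measure M A / 2 \<le> measure M (F k)" for k
      using above[of "m + 1 / real (Suc k)"] by (simp add: S_def F_def)
    ultimately show ?thesis using LIMSEQ_le_const[of "\<lambda>k. measure M (F k)"] by (metis (lifting))
  qed
  have less_half: "measure M {x \<in> A. s x < m} \<le> measure M A / 2"
  proof -
    define F where "F k = {x \<in> A. s x \<le> m - 1 / real (Suc k)}" for k
    have "(\<lambda>k. measure M (F k)) \<longlonglongrightarrow> measure M (\<Union>k. F k)"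
    proof (rule Lim_measure_incseq)
      show "range F \<subseteq> sets M" unfolding F_def by (auto intro!: sub)
      show "incseq F" unfolding F_def incseq_def
        by (auto intro: order.trans simp: frac_le)
      show "emeasure M (\<Union>k. F k) \<noteq> \<infinity>" by (rule fin) (auto simp: F_def)
    qed
    moreover have "(\<Union>k. F k) = {x \<in> A. s x < m}"
    proof (intro set_eqI iffI)
      fix x assume "x \<in> (\<Union>k. F k)"
      then obtain k where x: "x \<in> A" "s x \<le> m - 1 / real (Suc k)" by (auto simp: F_def)
      have "0 < 1 / real (Suc k)" by simp
      then have "s x < m" using x(2) by linarith
      then show "x \<in> {x \<in> A. s x < m}" using x by simp
    next
      fix x assume x: "x \<in> {x \<in> A. s x < m}"
      then obtain k where "1 / real (Suc k) < m - s x" using nat_approx_posE[of "m - s x"] by auto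
      then have "s x \<le> m - 1 / real (Suc k)" by linarith
      then have "x \<in> F k" using x by (simp add: F_def)
      then show "x \<in> (\<Union>k. F k)" by blast
    qed
    moreover have "measure M (F k) \<le> measure M A / 2" for k
      using below[of "m - 1 / real (Suc k)"] by (simp add: S_def F_def)
    ultimately show ?thesis using LIMSEQ_le_const2[of "\<lambda>k. measure M (F k)"] by (metis (lifting))
  qed
  have "measure M (A - {x \<in> A. s x < m}) = measure M A - measure M {x \<in> A. s x < m}"
    using A(1) fm[of "\<lambda>t. t < m"] As by (intro measurable_measure_Diff) auto
  moreover have "A - {x \<in> A. s x < m} = {x \<in> A. m \<le> s x}" by auto
  ultimately show thesis using that[OF m le_half] less_half by simp
qed

text \<open>
  The sum compares the value of \<open>m\<close> at \<open>i\<close> with its values at the translates of \<open>i\<close> by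
  \<open>t * v\<close>. For a pair of grid points differing by \<open>v\<close>, either the first sees a value at least as large at the second in direction
  \<open>1\<close>, or the second sees one at the first in direction \<open>- 1\<close>. If the grid is long compared with the displacements, at least half of
  its points have their translate in the grid, so the two sums for \<open>t = 1\<close> and \<open>t = - 1\<close> together have an average over \<open>i\<close> of at
  least \<open>N / 2\<close>.
\<close>

lemma half_of_pairs_ascend:
  fixes m :: "('n::finite \<Rightarrow> int) \<Rightarrow> real" and D :: "nat \<Rightarrow> ('n \<Rightarrow> int) set" and L B :: int
  defines "G \<equiv> PiE UNIV (\<lambda>_. {0..<L})"
  assumes D: "\<And>j. j < N \<Longrightarrow> finite (D j) \<and> D j \<noteq> {}"
    and bd: "\<And>j v b. j < N \<Longrightarrow> v \<in> D j \<Longrightarrow> \<bar>v b\<bar> \<le> B"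
    and L: "0 < L" "0 \<le> B" "4 * int CARD('n) * B \<le> L"
  shows "\<exists>i\<in>G. \<exists>t\<in>{1,-1}. real N / 4 \<le>
    (\<Sum>j<N. real (card {v \<in> D j. (\<lambda>b. i b + t * v b) \<in> G \<and> m i \<le> m (\<lambda>b. i b + t * v b)}) / real (card (D j)))"
proof (rule ccontr)
  define P where "P t i v \<longleftrightarrow> (\<lambda>b. i b + t * v b) \<in> G \<and> m i \<le> m (\<lambda>b. i b + t * v b)" for t i v
  define S where "S t i = (\<Sum>j<N. real (card {v \<in> D j. P t i v}) / real (card (D j)))" for t i
  assume "\<not> ?thesis"
  then have small: "S t i < real N / 4" if "i \<in> G" "t \<in> {1,-1}" for t i
    using that unfolding S_def P_def by force
  have finG: "finite G" unfolding G_def by (intro finite_PiE) auto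
  have cG: "real (card G) = real_of_int L ^ CARD('n)"
    using L(1) by (simp add: G_def card_PiE)
  have Gne: "G \<noteq> {}" using cG L(1) by auto
  define G' where "G' = PiE (UNIV :: 'n set) (\<lambda>_. {B..<L - B})"
  have nB: "2 * B \<le> L"
  proof -
    have "1 * B \<le> int CARD('n) * B" using L(2) by (intro mult_right_mono) (auto simp: Suc_le_eq)
    then show ?thesis using L by linarith
  qed
  have cG': "real (card G) / 2 \<le> real (card G')"
  proof -
    have eq: "real (card G') = (real_of_int L - 2 * of_int B) ^ CARD('n)"
      using nB by (simp add: G'_def card_PiE)
    have x: "2 * of_int B / of_int L \<le> (1 :: real)" using nB L(1) by (simp add: divide_simps)
    have "1 + real CARD('n) * (- (2 * of_int B / of_int L)) \<le> (1 + (- (2 * of_int B / of_int L))) ^ CARD('n)"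
      using x by (intro Bernoulli_inequality) simp
    moreover have "real CARD('n) * (2 * of_int B / of_int L) \<le> 1 / 2"
    proof -
      have "real_of_int (4 * int CARD('n) * B) \<le> of_int L" using L(3) by (simp only: of_int_le_iff)
      then show ?thesis using L(1) by (simp add: field_simps)
    qed
    ultimately have "1 / 2 \<le> (1 - 2 * real_of_int B / of_int L) ^ CARD('n)" by simp
    then have "real_of_int L ^ CARD('n) * (1 / 2) \<le> real_of_int L ^ CARD('n) * (1 - 2 * of_int B / of_int L) ^ CARD('n)"
      using L(1) by (intro mult_left_mono) auto
    also have "\<dots> = (real_of_int L - 2 * of_int B) ^ CARD('n)"
      using L(1) by (simp add: power_mult_distrib[symmetric] algebra_simps)
    finally show ?thesis by (simp add: cG eq)
  qed
  have pair: "real (card G) / 2 \<le> real (card {i \<in> G. P 1 i v}) + real (card {i \<in> G. P (-1) i v})"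
    if "j < N" "v \<in> D j" for j v
  proof -
    let ?A = "{i \<in> G. P 1 i v}" and ?B = "{i \<in> G. P (-1) i v}"
    let ?f = "\<lambda>i b. i b + - 1 * v b"
    have sub: "G' \<subseteq> ?A \<union> ?f ` ?B"
    proof
      fix i assume i: "i \<in> G'"
      define k where "k = (\<lambda>b. i b + 1 * v b)"
      have "i \<in> G" "k \<in> G"
      proof -
        have "B \<le> i b \<and> i b < L - B" for b using i by (auto simp: G'_def PiE_iff)
        moreover have "- B \<le> v b \<and> v b \<le> B" for b using bd[OF that, of b] by (simp add: abs_le_iff)
        ultimately have "0 \<le> i b \<and> i b < L \<and> 0 \<le> k b \<and> k b < L" for b
          using L(2) unfolding k_def by (smt (verit))
        then show "i \<in> G" "k \<in> G" by (auto simp: G_def PiE_iff)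
      qed
      moreover have "i = ?f k" by (auto simp: k_def)
      ultimately show "i \<in> ?A \<union> ?f ` ?B"
      proof (cases "m i \<le> m k")
        case True
        then show ?thesis using \<open>i \<in> G\<close> \<open>k \<in> G\<close> by (simp add: P_def k_def)
      next
        case False
        then have "P (-1) k v" using \<open>i \<in> G\<close> \<open>i = ?f k\<close> unfolding P_def by auto
        then show ?thesis using \<open>i = ?f k\<close> \<open>k \<in> G\<close> by blast
      qed
    qed
    have "card G' \<le> card (?A \<union> ?f ` ?B)" using sub finG by (intro card_mono) auto
    also have "\<dots> \<le> card ?A + card (?f ` ?B)" by (rule card_Un_le)
    also have "\<dots> \<le> card ?A + card ?B" using finG by (intro add_left_mono card_image_le) auto
    finally show ?thesis using cG' by linarith
  qed
  have swap: "(\<Sum>i\<in>G. real (card {v \<in> D j. P t i v})) = (\<Sum>v\<in>D j. real (card {i \<in> G. P t i v}))" if "j < N" for j t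
  proof -
    have "(\<Sum>i\<in>G. real (card {v \<in> D j. P t i v})) = (\<Sum>i\<in>G. \<Sum>v\<in>D j. if P t i v then 1 else 0)"
      using D[OF that] by (intro sum.cong refl) (simp add: sum.If_cases Int_def)
    also have "\<dots> = (\<Sum>v\<in>D j. \<Sum>i\<in>G. if P t i v then 1 else 0)" by (rule sum.swap)
    also have "\<dots> = (\<Sum>v\<in>D j. real (card {i \<in> G. P t i v}))"
      using finG by (intro sum.cong refl) (simp add: sum.If_cases Int_def)
    finally show ?thesis .
  qed
  have level: "real (card G) / 2 \<le>
      (\<Sum>i\<in>G. real (card {v \<in> D j. P 1 i v}) / real (card (D j)) + real (card {v \<in> D j. P (-1) i v}) / real (card (D j)))"
    if "j < N" for j
  proof -
    have c: "0 < real (card (D j))" using D[OF that] by (simp add: card_gt_0_iff)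
    have "real (card (D j)) * (real (card G) / 2) = (\<Sum>v\<in>D j. real (card G) / 2)" by simp
    also have "\<dots> \<le> (\<Sum>v\<in>D j. real (card {i \<in> G. P 1 i v}) + real (card {i \<in> G. P (-1) i v}))"
      using pair[OF that] by (rule sum_mono)
    also have "\<dots> = (\<Sum>i\<in>G. real (card {v \<in> D j. P 1 i v}) + real (card {v \<in> D j. P (-1) i v}))"
      using swap[OF that] by (simp add: sum.distrib)
    finally show ?thesis using c
      by (simp add: add_divide_distrib[symmetric] sum_divide_distrib[symmetric] pos_le_divide_eq mult.commute)
  qed
  have "real N * (real (card G) / 2) = (\<Sum>j<N. real (card G) / 2)" by simp
  also have "\<dots> \<le> (\<Sum>j<N. \<Sum>i\<in>G. real (card {v \<in> D j. P 1 i v}) / real (card (D j)) + real (card {v \<in> D j. P (-1) i v}) / real (card (D j)))"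
    using level by (intro sum_mono) auto
  also have "\<dots> = (\<Sum>i\<in>G. S 1 i + S (-1) i)"
    unfolding S_def by (subst sum.swap) (simp add: sum.distrib)
  also have "\<dots> < (\<Sum>i\<in>G. real N / 2)"
    using finG Gne small[of _ 1] small[of _ "-1"] by (intro sum_strict_mono) force+
  finally show False by simp
qed

section \<open>Clusters of cubes with ordered exponents\<close>

text \<open>
  The geometric input for both bounds: a set \<open>F\<close> at scale \<open>r\<close>, and on each of the \<open>N\<close> dyadic scales \<open>r * 2 ^ j\<close> a set
  \<open>U j\<close> in the cone around \<open>w\<close>, such that \<open>s\<close> on \<open>F\<close> never exceeds \<open>s\<close> on the \<open>U j\<close>. Each scale fills its ball up to a constant
  on average, and the constants do not depend on \<open>\<epsilon>\<close>, \<open>r\<close> or \<open>E\<close>; this is what makes the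
  lemma usable although \<open>r\<close> cannot be controlled. Here \<open>F\<close> is the part of a cell below its median, and \<open>U j\<close> collects the
  upper parts of those cells whose median is at least as large.
\<close>

lemma monotone_cluster_family:
  fixes E :: "(real^'n::finite) set" and s :: "real^'n \<Rightarrow> real" and A R0 :: real
  assumes E: "E \<in> sets lebesgue" "emeasure lebesgue E \<noteq> 0"
    and s: "s \<in> borel_measurable lebesgue" "\<And>x. x \<in> E \<Longrightarrow> 0 \<le> s x \<and> s x \<le> \<epsilon>"
    and u: "norm u = 1" and A: "0 \<le> A" and R0: "0 < R0"
  obtains r y w m F U where
    "0 < r" "r < R0" "w = u \<or> w = - u" "0 \<le> m" "m \<le> \<epsilon>"
    "F \<in> sets lebesgue" "F \<subseteq> E \<inter> cball y (real CARD('n) * r)" "\<And>x. x \<in> F \<Longrightarrow> s x \<le> m"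
    "r ^ CARD('n) / 4 \<le> measure lebesgue F" "measure lebesgue F \<le> r ^ CARD('n)"
    "\<And>j. j < N \<Longrightarrow> U j \<in> sets lebesgue"
    "\<And>j. j < N \<Longrightarrow> U j \<subseteq> E \<inter> cball (y + (A * (r * 2 ^ j)) *\<^sub>R w) (2 * real CARD('n) * (r * 2 ^ j))"
    "\<And>j x. j < N \<Longrightarrow> x \<in> U j \<Longrightarrow> m \<le> s x"
    "\<And>j. j < N \<Longrightarrow> measure lebesgue (U j) \<le> (r * 2 ^ j) ^ CARD('n)"
    "real N / 16 \<le> (\<Sum>j<N. measure lebesgue (U j) / (r * 2 ^ j) ^ CARD('n))"
proof -
  let ?n = "CARD('n)"
  define f where "f j b = \<lfloor>2 ^ j * A * u $ b\<rfloor>" for j :: nat and b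
  \<comment> \<open>The displacements of scale \<open>j\<close>: the integer points of a half-open cube of side \<open>2 ^ j\<close> near \<open>2 ^ j * A * u\<close>.
    The rounding makes their number exactly \<open>(2 ^ j) ^ n\<close>.\<close>
  define D where "D j = PiE (UNIV :: 'n set) (\<lambda>b. {f j b ..< f j b + 2 ^ j})" for j
  have cD: "real (card (D j)) = (2 ^ j) ^ ?n" for j
    by (simp add: D_def card_PiE)
  have finD: "finite (D j)" and neD: "D j \<noteq> {}" for j
    by (auto simp: D_def PiE_eq_empty_iff intro!: finite_PiE)
  define B where "B = \<lceil>2 ^ N * (A + 2)\<rceil>"
  have "0 \<le> 2 ^ N * (A + 2)" using A by simp
  then have B0: "0 \<le> B" unfolding B_def zero_le_ceiling by linarith
  have bd: "\<bar>v b\<bar> \<le> B" if "j < N" "v \<in> D j" for j v b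
  proof -
    have vb: "f j b \<le> v b" "v b < f j b + 2 ^ j" using that(2) by (auto simp: D_def PiE_iff)
    have "\<bar>u $ b\<bar> \<le> 1" using component_le_norm_cart[of u b] u by simp
    then have "\<bar>2 ^ j * A * u $ b\<bar> \<le> 2 ^ j * A"
      using A by (simp add: abs_mult mult_left_le)
    then have "\<bar>real_of_int (f j b)\<bar> \<le> 2 ^ j * A + 1" unfolding f_def by linarith
    moreover have "real_of_int (f j b) \<le> of_int (v b)" using vb(1) by simp
    moreover have "real_of_int (v b) < real_of_int (f j b + 2 ^ j)"
      using vb(2) by (simp only: of_int_less_iff)
    then have "real_of_int (v b) < of_int (f j b) + 2 ^ j" by simp
    moreover have "(1 :: real) \<le> 2 ^ j" by simp
    ultimately have "\<bar>real_of_int (v b)\<bar> \<le> 2 ^ j * A + 2 * 2 ^ j" by linarith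
    also have "\<dots> = 2 ^ j * (A + 2)" by (simp add: algebra_simps)
    also have "\<dots> \<le> 2 ^ N * (A + 2)" using that(1) A by (intro mult_right_mono power_increasing) auto
    finally show ?thesis unfolding B_def by linarith
  qed
  define L where "L = max 1 (4 * int ?n * B)"
  have L: "0 < L" "4 * int ?n * B \<le> L" by (auto simp: L_def)
  then have rL: "0 < real_of_int L" "1 \<le> real_of_int L" by auto
  \<comment> \<open>The exceptional set in the large cell has less than half the measure of a small cell,
    so every one of the small cells is at least half filled by \<open>E\<close>.\<close>
  define \<eta> where "\<eta> = 1 / (2 * real_of_int L ^ ?n)"
  have "0 < \<eta>" using rL by (simp add: \<eta>_def)
  obtain R i0 where R: "0 < R" "R < R0" "measure lebesgue (grid_cell R i0 - E) < \<eta> * R ^ ?n"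
    using dense_grid_cell[OF E \<open>0 < \<eta>\<close> R0] by blast
  define r where "r = R / of_int L"
  have r: "0 < r" "r * of_int L = R" "r \<le> R" using R rL by (auto simp: r_def divide_simps)
  have \<eta>r: "\<eta> * R ^ ?n = r ^ ?n / 2" using rL by (simp add: \<eta>_def r_def power_divide)
  define G where "G = PiE (UNIV :: 'n set) (\<lambda>_. {0..<L})"
  define c where "c i = grid_cell r (\<lambda>b. L * i0 b + i b)" for i
  have cl: "c i \<in> lmeasurable" and cm: "measure lebesgue (c i) = r ^ ?n" for i
    using grid_cell_measure[OF r(1)] by (auto simp: c_def)
  have cEl: "c i \<inter> E \<in> lmeasurable" for i
    using cl E(1) by (intro fmeasurableI2[OF cl]) auto
  have cE: "r ^ ?n / 2 \<le> measure lebesgue (c i \<inter> E)" if "i \<in> G" for i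
  proof -
    have "c i \<subseteq> grid_cell R i0"
    proof
      fix x assume x: "x \<in> c i"
      have "R * of_int (i0 b) \<le> x $ b \<and> x $ b < R * (of_int (i0 b) + 1)" for b
      proof -
        have "0 \<le> i b \<and> i b < L" using that by (auto simp: G_def PiE_iff)
        then have ib: "0 \<le> i b" "i b + 1 \<le> L" by simp_all
        have rib: "(0::real) \<le> of_int (i b)" "of_int (i b) + 1 \<le> real_of_int L"
          using ib by linarith+
        have "r * (of_int L * of_int (i0 b) + of_int (i b)) \<le> x $ b"
          "x $ b < r * (of_int L * of_int (i0 b) + of_int (i b) + 1)"
          using x by (auto simp: c_def grid_cell_def)
        moreover have "r * (of_int L * of_int (i0 b) + of_int (i b)) = R * of_int (i0 b) + r * of_int (i b)"
          "r * (of_int L * of_int (i0 b) + of_int (i b) + 1) = R * of_int (i0 b) + r * (of_int (i b) + 1)"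
          using r(2) by (simp_all add: algebra_simps)
        ultimately have "R * of_int (i0 b) + r * of_int (i b) \<le> x $ b"
          "x $ b < R * of_int (i0 b) + r * (of_int (i b) + 1)" by simp_all
        moreover have "0 \<le> r * of_int (i b)" "r * (of_int (i b) + 1) \<le> R"
          using rib r(1) unfolding r(2)[symmetric] by auto
        moreover have "R * (of_int (i0 b) + 1) = R * of_int (i0 b) + R" by (simp add: algebra_simps)
        ultimately show ?thesis by linarith
      qed
      then show "x \<in> grid_cell R i0" by (simp add: grid_cell_def)
    qed
    then have "measure lebesgue (c i - E) \<le> measure lebesgue (grid_cell R i0 - E)"
      using E(1) fmeasurableD[OF cl]
      by (intro measure_mono_fmeasurable fmeasurableI2[OF grid_cell_measure(1)[OF R(1)]]) auto
    then have "measure lebesgue (c i - E) \<le> r ^ ?n / 2" using R(3) \<eta>r by simp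
    moreover have "measure lebesgue (c i - (c i \<inter> E)) = measure lebesgue (c i) - measure lebesgue (c i \<inter> E)"
      using cl cEl by (intro measurable_measure_Diff) auto
    moreover have "c i - (c i \<inter> E) = c i - E" by auto
    ultimately show ?thesis using cm[of i] by simp
  qed
  have "\<exists>m. 0 \<le> m \<and> m \<le> \<epsilon> \<and> r ^ ?n / 4 \<le> measure lebesgue {x \<in> c i \<inter> E. s x \<le> m} \<and>
      r ^ ?n / 4 \<le> measure lebesgue {x \<in> c i \<inter> E. m \<le> s x}" if "i \<in> G" for i
  proof -
    have "0 < measure lebesgue (c i \<inter> E)" using cE[OF that] r(1)
      by (smt (verit) half_gt_zero zero_less_power)
    then obtain m where "0 \<le> m" "m \<le> \<epsilon>"
      "measure lebesgue (c i \<inter> E) / 2 \<le> measure lebesgue {x \<in> c i \<inter> E. s x \<le> m}"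
      "measure lebesgue (c i \<inter> E) / 2 \<le> measure lebesgue {x \<in> c i \<inter> E. m \<le> s x}"
      using median_split[OF cEl _ s(1), of i \<epsilon>] s(2) by blast
    then show ?thesis using cE[OF that] by (intro exI[of _ m]) linarith
  qed
  then have "\<forall>i\<in>G. \<exists>m. 0 \<le> m \<and> m \<le> \<epsilon> \<and> r ^ ?n / 4 \<le> measure lebesgue {x \<in> c i \<inter> E. s x \<le> m} \<and>
      r ^ ?n / 4 \<le> measure lebesgue {x \<in> c i \<inter> E. m \<le> s x}" by blast
  from bchoice[OF this] obtain m where m': "\<forall>i\<in>G. 0 \<le> m i \<and> m i \<le> \<epsilon> \<and>
      r ^ ?n / 4 \<le> measure lebesgue {x \<in> c i \<inter> E. s x \<le> m i} \<and>
      r ^ ?n / 4 \<le> measure lebesgue {x \<in> c i \<inter> E. m i \<le> s x}" by (rule exE)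
  have m: "\<And>i. i \<in> G \<Longrightarrow> 0 \<le> m i" "\<And>i. i \<in> G \<Longrightarrow> m i \<le> \<epsilon>"
      "\<And>i. i \<in> G \<Longrightarrow> r ^ ?n / 4 \<le> measure lebesgue {x \<in> c i \<inter> E. s x \<le> m i}"
      "\<And>i. i \<in> G \<Longrightarrow> r ^ ?n / 4 \<le> measure lebesgue {x \<in> c i \<inter> E. m i \<le> s x}"
    using m' by blast+
  have "\<exists>i\<in>G. \<exists>t\<in>{1,-1}. real N / 4 \<le>
    (\<Sum>j<N. real (card {v \<in> D j. (\<lambda>b. i b + t * v b) \<in> G \<and> m i \<le> m (\<lambda>b. i b + t * v b)}) / real (card (D j)))"
    unfolding G_def using finD neD bd L B0 by (intro half_of_pairs_ascend[where B = B]) auto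
  then obtain i t where i: "i \<in> G" and t0: "t \<in> {1, - 1}" and it: "real N / 4 \<le>
    (\<Sum>j<N. real (card {v \<in> D j. (\<lambda>b. i b + t * v b) \<in> G \<and> m i \<le> m (\<lambda>b. i b + t * v b)}) / real (card (D j)))"
    by blast
  have t: "t = 1 \<or> t = - 1" using t0 by simp
  define k where "k v = (\<lambda>b. i b + t * v b)" for v
  define V where "V j = {v \<in> D j. k v \<in> G \<and> m i \<le> m (k v)}" for j
  define F where "F = {x \<in> c i \<inter> E. s x \<le> m i}"
  define W where "W v = {x \<in> c (k v) \<inter> E. m (k v) \<le> s x}" for v
  define U where "U j = (\<Union>v\<in>V j. W v)" for j
  define y :: "real^'n" where "y = (\<chi> b. r * of_int (L * i0 b + i b))"
  define w where "w = real_of_int t *\<^sub>R u"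
  have meas: "{x \<in> c i \<inter> E. s x \<le> a} \<in> sets lebesgue" "{x \<in> c i \<inter> E. a \<le> s x} \<in> sets lebesgue" for i a
  proof -
    have "{x \<in> space lebesgue. s x \<le> a} \<in> sets lebesgue" "{x \<in> space lebesgue. a \<le> s x} \<in> sets lebesgue"
      using s(1) by measurable
    then have "(c i \<inter> E) \<inter> {x. s x \<le> a} \<in> sets lebesgue" "(c i \<inter> E) \<inter> {x. a \<le> s x} \<in> sets lebesgue"
      using cEl by auto
    moreover have "{x \<in> c i \<inter> E. s x \<le> a} = (c i \<inter> E) \<inter> {x. s x \<le> a}" "{x \<in> c i \<inter> E. a \<le> s x} = (c i \<inter> E) \<inter> {x. a \<le> s x}"
      by auto
    ultimately show "{x \<in> c i \<inter> E. s x \<le> a} \<in> sets lebesgue" "{x \<in> c i \<inter> E. a \<le> s x} \<in> sets lebesgue" by simp_all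
  qed
  have Wl: "W v \<in> lmeasurable" and Wc: "W v \<subseteq> c (k v)" and WE: "W v \<subseteq> E" for v
    unfolding W_def using meas by (auto intro!: fmeasurableI2[OF cl[of "k v"]])
  have finV: "finite (V j)" for j using finD by (simp add: V_def)
  have kinj: "v = v'" if "k v = k v'" for v v'
    using that t by (auto simp: k_def fun_eq_iff)
  have disj: "W v \<inter> W v' = {}" if "v \<noteq> v'" for v v'
  proof (rule ccontr)
    assume "W v \<inter> W v' \<noteq> {}"
    then obtain x where "x \<in> c (k v)" "x \<in> c (k v')" using Wc by blast
    then have "(\<lambda>b. L * i0 b + k v b) = (\<lambda>b. L * i0 b + k v' b)"
      using grid_cell_disjoint[OF r(1)] unfolding c_def by blast
    then have "k v = k v'" by (simp add: fun_eq_iff)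
    then show False using kinj that by blast
  qed
  have mU: "measure lebesgue (U j) = (\<Sum>v\<in>V j. measure lebesgue (W v))" for j
    unfolding U_def using finV Wl disj by (intro measure_UNION') (auto simp: pairwise_def disjnt_def)
  have sub: "U j \<subseteq> cball (y + (A * (r * 2 ^ j)) *\<^sub>R w) (2 * real ?n * (r * 2 ^ j))" for j
  proof
    fix x assume "x \<in> U j"
    then obtain v where v: "v \<in> D j" "x \<in> c (k v)" using Wc by (auto simp: U_def V_def)
    define z :: "real^'n" where "z = (\<chi> b. r * of_int (L * i0 b + k v b))"
    have "dist z x \<le> real ?n * r"
      using subsetD[OF grid_cell_subset_cball v(2)[unfolded c_def]] unfolding z_def by simp
    also have "\<dots> \<le> real ?n * (r * 2 ^ j)" using r(1) by (intro mult_left_mono) auto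
    finally have 1: "dist z x \<le> real ?n * (r * 2 ^ j)" .
    have "norm (y + (A * (r * 2 ^ j)) *\<^sub>R w - z) \<le> (\<Sum>b\<in>UNIV. \<bar>(y + (A * (r * 2 ^ j)) *\<^sub>R w - z) $ b\<bar>)"
      by (rule norm_le_l1_cart)
    also have "\<dots> \<le> (\<Sum>b\<in>(UNIV::'n set). r * 2 ^ j)"
    proof (rule sum_mono)
      fix b
      have vb: "f j b \<le> v b" "v b < f j b + 2 ^ j" using v(1) by (auto simp: D_def PiE_iff)
      have "real_of_int (f j b) \<le> of_int (v b)" using vb(1) by simp
      moreover have "v b + 1 \<le> f j b + 2 ^ j" using vb(2) by simp
      then have "real_of_int (v b + 1) \<le> real_of_int (f j b + 2 ^ j)" by (simp only: of_int_le_iff)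
      then have "real_of_int (v b) + 1 \<le> of_int (f j b) + 2 ^ j" by simp
      moreover have "of_int (f j b) \<le> 2 ^ j * A * u $ b" "2 ^ j * A * u $ b < of_int (f j b) + 1"
        by (auto simp: f_def)
      moreover have "(1 :: real) \<le> 2 ^ j" by simp
      ultimately have *: "\<bar>2 ^ j * A * u $ b - of_int (v b)\<bar> \<le> 2 ^ j" by linarith
      have "(y + (A * (r * 2 ^ j)) *\<^sub>R w - z) $ b = r * of_int t * (2 ^ j * A * u $ b - of_int (v b))"
        by (simp add: y_def z_def w_def k_def algebra_simps)
      also have "\<bar>\<dots>\<bar> = r * \<bar>2 ^ j * A * u $ b - of_int (v b)\<bar>"
        using r(1) t by (auto simp: abs_mult)
      also have "\<dots> \<le> r * 2 ^ j" using * r(1) by (intro mult_left_mono) auto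
      finally show "\<bar>(y + (A * (r * 2 ^ j)) *\<^sub>R w - z) $ b\<bar> \<le> r * 2 ^ j" .
    qed
    also have "\<dots> = real ?n * (r * 2 ^ j)" by simp
    finally have 2: "dist (y + (A * (r * 2 ^ j)) *\<^sub>R w) z \<le> real ?n * (r * 2 ^ j)"
      by (simp add: dist_norm)
    show "x \<in> cball (y + (A * (r * 2 ^ j)) *\<^sub>R w) (2 * real ?n * (r * 2 ^ j))"
      using dist_triangle[of "y + (A * (r * 2 ^ j)) *\<^sub>R w" x z] 1 2 by simp
  qed
  show thesis
  proof (rule that[of r w "m i" F y U])
    show "0 < r" "r < R0" using r R by auto
    show "w = u \<or> w = - u" using t by (auto simp: w_def)
    show "0 \<le> m i" "m i \<le> \<epsilon>" using m i by auto
    show "F \<in> sets lebesgue" unfolding F_def by (rule meas)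
    have "c i \<subseteq> cball y (real ?n * r)"
      using grid_cell_subset_cball[of r "\<lambda>b. L * i0 b + i b"] unfolding y_def c_def by simp
    then show "F \<subseteq> E \<inter> cball y (real ?n * r)" by (auto simp: F_def)
    show "s x \<le> m i" if "x \<in> F" for x using that by (simp add: F_def)
    show "r ^ ?n / 4 \<le> measure lebesgue F" unfolding F_def using m(3)[OF i] .
    have "measure lebesgue F \<le> measure lebesgue (c i)"
      using cl meas by (intro measure_mono_fmeasurable) (auto simp: F_def)
    then show "measure lebesgue F \<le> r ^ ?n" by (simp add: cm)
    show "U j \<in> sets lebesgue" for j unfolding U_def using finV Wl by (intro sets.finite_UN fmeasurableD)
    show "U j \<subseteq> E \<inter> cball (y + (A * (r * 2 ^ j)) *\<^sub>R w) (2 * real ?n * (r * 2 ^ j))" for j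
      using sub WE by (auto simp: U_def)
    show "m i \<le> s x" if "x \<in> U j" for j x
      using that by (auto simp: U_def V_def W_def)
    show "measure lebesgue (U j) \<le> (r * 2 ^ j) ^ ?n" for j
    proof -
      have "measure lebesgue (U j) \<le> (\<Sum>v\<in>V j. r ^ ?n)"
        unfolding mU
      proof (rule sum_mono)
        fix v
        have "measure lebesgue (W v) \<le> measure lebesgue (c (k v))"
          using cl Wl Wc by (intro measure_mono_fmeasurable) auto
        then show "measure lebesgue (W v) \<le> r ^ ?n" by (simp add: cm)
      qed
      also have "\<dots> = real (card (V j)) * r ^ ?n" by simp
      also have "\<dots> \<le> real (card (D j)) * r ^ ?n"
        using r(1) finD by (intro mult_right_mono) (auto simp: V_def intro!: card_mono)
      finally show ?thesis by (simp add: cD power_mult_distrib mult.commute)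
    qed
    have "real N / 16 \<le> (\<Sum>j<N. real (card (V j)) / real (card (D j))) / 4"
      using it by (simp add: V_def k_def)
    also have "\<dots> = (\<Sum>j<N. real (card (V j)) * (r ^ ?n / 4) / (r * 2 ^ j) ^ ?n)"
      using r(1) by (simp add: sum_divide_distrib cD power_mult_distrib mult.commute)
    also have "\<dots> \<le> (\<Sum>j<N. measure lebesgue (U j) / (r * 2 ^ j) ^ ?n)"
    proof (intro sum_mono divide_right_mono)
      fix j
      have "real (card (V j)) * (r ^ ?n / 4) = (\<Sum>v\<in>V j. r ^ ?n / 4)" by simp
      also have "\<dots> \<le> measure lebesgue (U j)"
        unfolding mU using m(4) by (intro sum_mono) (auto simp: V_def W_def)
      finally show "real (card (V j)) * (r ^ ?n / 4) \<le> measure lebesgue (U j)" .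
    qed (use r in auto)
    finally show "real N / 16 \<le> (\<Sum>j<N. measure lebesgue (U j) / (r * 2 ^ j) ^ ?n)" .
  qed
qed

section \<open>The kernel on cones and the operator on step functions\<close>

text \<open>
  On the line through \<open>y\<close> in direction \<open>u\<close> the kernel is large by non-degeneracy; the smoothness estimate moves the
  first and then the second argument over balls whose radius is \<open>2 * n / A\<close> times the distance, and for large \<open>A\<close> this
  changes the value by a quarter at most. The single value \<open>\<kappa>\<close> for all pairs is needed because the phase of \<open>K\<close> would
  otherwise allow cancellation in the kernel integral.
\<close>

lemma kernel_size_on_cones:
  fixes K :: "real^'n::finite \<Rightarrow> real^'n \<Rightarrow> 'k::{real_normed_field,euclidean_space}"
  assumes \<alpha>: "\<alpha> < real CARD('n)" and K: "fractional_CZ_kernel \<alpha> K" and nd: "nondegenerate_kernel \<alpha> K"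
  obtains A c u where "norm u = 1" "0 < c" "8 * real CARD('n) < A"
    "\<And>y \<rho> w. 0 < \<rho> \<Longrightarrow> w = u \<or> w = - u \<Longrightarrow> \<exists>\<kappa>. c * \<rho> powr (\<alpha> - real CARD('n)) \<le> norm \<kappa> \<and>
       (\<forall>x\<in>cball (y + (A * \<rho>) *\<^sub>R w) (2 * real CARD('n) * \<rho>). \<forall>z\<in>cball y (2 * real CARD('n) * \<rho>).
          norm (K x z - \<kappa>) \<le> norm \<kappa> / 4)"
proof -
  let ?n = "real CARD('n)"
  define d where "d = ?n - \<alpha>"
  have d: "0 < d" using \<alpha> by (simp add: d_def)
  obtain C \<delta> where \<delta>: "0 < \<delta>" and smooth: "\<And>x y h. x \<noteq> y \<Longrightarrow> norm h < norm (x - y) / 2 \<Longrightarrow>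
     norm (K (x + h) y - K x y) + norm (K x (y + h) - K x y) \<le> C * norm h powr \<delta> / norm (x - y) powr (d + \<delta>)"
    using K unfolding fractional_CZ_kernel_def d_def by blast
  obtain a u where a: "0 < a" and u: "norm u = 1" and lower:
    "\<And>x y. x \<noteq> y \<Longrightarrow> (\<exists>t. x - y = t *\<^sub>R u) \<Longrightarrow> a / norm (x - y) powr d \<le> norm (K x y)"
    using nd unfolding nondegenerate_kernel_def d_def by blast
  define C0 where "C0 = max C 0 + 1"
  have C0: "0 < C0" by (simp add: C0_def)
  have smooth0: "norm (K (x + h) y - K x y) + norm (K x (y + h) - K x y) \<le> C0 * norm h powr \<delta> / norm (x - y) powr (d + \<delta>)"
    if "x \<noteq> y" "norm h < norm (x - y) / 2" for x y h
  proof -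
    have "C * norm h powr \<delta> / norm (x - y) powr (d + \<delta>) \<le> C0 * norm h powr \<delta> / norm (x - y) powr (d + \<delta>)"
      by (intro divide_right_mono mult_right_mono) (auto simp: C0_def)
    then show ?thesis using smooth[OF that] by linarith
  qed
  define \<eta> where "\<eta> = a / (4 * C0 * (1 + 2 powr (d + \<delta>)))"
  have p1: "0 < 1 + 2 powr (d + \<delta>)" by (simp add: add_pos_pos)
  have \<eta>: "0 < \<eta>" using a C0 p1 by (simp add: \<eta>_def)
  \<comment> \<open>The first entry separates the balls and keeps increments below half the distance; the second one makes the
    accumulated smoothness error at most a quarter of the lower bound.\<close>
  define A where "A = max (8 * ?n + 1) (2 * ?n / \<eta> powr (1 / \<delta>))"
  have A: "8 * ?n < A" by (simp add: A_def)
  then have A0: "0 < A" by (smt (verit) of_nat_0_le_iff)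
  have "2 * ?n / \<eta> powr (1 / \<delta>) \<le> A" by (simp add: A_def)
  then have "2 * ?n / A \<le> \<eta> powr (1 / \<delta>)" using A0 \<eta> by (simp add: divide_simps mult.commute)
  then have "(2 * ?n / A) powr \<delta> \<le> (\<eta> powr (1 / \<delta>)) powr \<delta>"
    using A0 \<delta> by (intro powr_mono2) auto
  also have "\<dots> = \<eta>" using \<delta> \<eta> by (simp add: powr_powr)
  finally have A\<eta>: "(2 * ?n / A) powr \<delta> \<le> \<eta>" .
  show thesis
  proof (rule that[OF u _ A, of "a * A powr (- d)"])
    show "0 < a * A powr (- d)" using a A0 by simp
    fix y w :: "real^'n" and \<rho> :: real
    assume \<rho>: "0 < \<rho>" and w: "w = u \<or> w = - u"
    define x0 where "x0 = y + (A * \<rho>) *\<^sub>R w"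
    define \<kappa> where "\<kappa> = K x0 y"
    have A\<rho>: "0 < A * \<rho>" using A0 \<rho> by simp
    have nx0: "norm (x0 - y) = A * \<rho>" using w u A\<rho> by (auto simp: x0_def)
    then have ne0: "x0 \<noteq> y" using A\<rho> by auto
    have "\<exists>t. x0 - y = t *\<^sub>R u"
      using w by (auto simp: x0_def intro: exI[of _ "A * \<rho>"] exI[of _ "- (A * \<rho>)"])
    then have \<kappa>low: "a / (A * \<rho>) powr d \<le> norm \<kappa>" using lower[OF ne0] nx0 by (simp add: \<kappa>_def)
    define e where "e = (2 * ?n * \<rho>) powr \<delta>"
    have e: "e = (2 * ?n / A) powr \<delta> * (A * \<rho>) powr \<delta>"
      using A0 \<rho> by (simp add: e_def powr_mult[symmetric] mult.assoc)
    have "norm (K x z - \<kappa>) \<le> norm \<kappa> / 4"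
      if x: "x \<in> cball x0 (2 * ?n * \<rho>)" and z: "z \<in> cball y (2 * ?n * \<rho>)" for x z
    proof -
      define h where "h = x - x0"
      define k where "k = z - y"
      have h: "norm h \<le> 2 * ?n * \<rho>" using x by (simp add: h_def dist_norm norm_minus_commute)
      have k: "norm k \<le> 2 * ?n * \<rho>" using z by (simp add: k_def dist_norm norm_minus_commute)
      have n0: "0 \<le> ?n * \<rho>" using \<rho> by simp
      have big: "8 * ?n * \<rho> < A * \<rho>" using A \<rho> by simp
      have 1: "norm (K (x0 + h) y - K x0 y) \<le> C0 * e / (A * \<rho>) powr (d + \<delta>)"
      proof -
        have "norm h < norm (x0 - y) / 2" using h big nx0 n0 by linarith
        then have "norm (K (x0 + h) y - K x0 y) \<le> C0 * norm h powr \<delta> / (A * \<rho>) powr (d + \<delta>)"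
          using smooth0[OF ne0, of h] nx0 by (smt (verit) norm_ge_zero)
        also have "\<dots> \<le> C0 * e / (A * \<rho>) powr (d + \<delta>)"
          unfolding e_def using C0 h \<delta> by (intro divide_right_mono mult_left_mono powr_mono2) auto
        finally show ?thesis .
      qed
      have xy: "A * \<rho> / 2 \<le> norm (x - y)"
      proof -
        have "norm (x0 - y) \<le> norm (x - y) + norm h"
          using norm_triangle_ineq4[of "x - y" "x - x0"] by (simp add: h_def)
        then show ?thesis using h big nx0 n0 by linarith
      qed
      have nexy: "x \<noteq> y" using xy A\<rho> by auto
      have 2: "norm (K x (y + k) - K x y) \<le> C0 * e * 2 powr (d + \<delta>) / (A * \<rho>) powr (d + \<delta>)"
      proof -
        have "norm k < norm (x - y) / 2" using k big xy n0 by linarith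
        then have "norm (K x (y + k) - K x y) \<le> C0 * norm k powr \<delta> / norm (x - y) powr (d + \<delta>)"
          using smooth0[OF nexy, of k] by (smt (verit) norm_ge_zero)
        also have "\<dots> \<le> C0 * e / (A * \<rho> / 2) powr (d + \<delta>)"
          unfolding e_def using C0 k \<delta> d xy A\<rho> by (intro frac_le mult_left_mono powr_mono2) auto
        also have "\<dots> = C0 * e * 2 powr (d + \<delta>) / (A * \<rho>) powr (d + \<delta>)"
          using A\<rho> by (simp add: powr_divide)
        finally show ?thesis .
      qed
      have "K x z - \<kappa> = (K x (y + k) - K x y) + (K (x0 + h) y - K x0 y)"
        by (simp add: h_def k_def \<kappa>_def)
      then have "norm (K x z - \<kappa>) \<le> norm (K x (y + k) - K x y) + norm (K (x0 + h) y - K x0 y)"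
        by (metis norm_triangle_ineq)
      also have "\<dots> \<le> C0 * e * 2 powr (d + \<delta>) / (A * \<rho>) powr (d + \<delta>) + C0 * e / (A * \<rho>) powr (d + \<delta>)"
        using 1 2 by (rule add_mono[rotated])
      also have "\<dots> = C0 * (1 + 2 powr (d + \<delta>)) * (e / (A * \<rho>) powr (d + \<delta>))"
        by (simp add: add_divide_distrib algebra_simps)
      also have "e / (A * \<rho>) powr (d + \<delta>) = (2 * ?n / A) powr \<delta> / (A * \<rho>) powr d"
        using A\<rho> by (simp add: e powr_add)
      also have "C0 * (1 + 2 powr (d + \<delta>)) * \<dots> \<le> C0 * (1 + 2 powr (d + \<delta>)) * (\<eta> / (A * \<rho>) powr d)"
        using A\<eta> C0 p1 by (intro mult_left_mono divide_right_mono) auto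
      also have "\<dots> = (a / (A * \<rho>) powr d) / 4"
      proof -
        have "C0 * X * (a / (4 * C0 * X)) = a / 4" if "X \<noteq> 0" for X
          using C0 that by (simp add: field_simps)
        from this[of "1 + 2 powr (d + \<delta>)"] p1
        have "C0 * (1 + 2 powr (d + \<delta>)) * \<eta> = a / 4" unfolding \<eta>_def by linarith
        then have "C0 * (1 + 2 powr (d + \<delta>)) * (\<eta> / Y) = a / 4 / Y" for Y
          by (simp only: times_divide_eq_right)
        moreover have "a / 4 / Y = a / Y / 4" for Y by simp
        ultimately show ?thesis by (simp only:)
      qed
      also have "\<dots> \<le> norm \<kappa> / 4" using \<kappa>low by simp
      finally show ?thesis .
    qed
    moreover have "a * A powr (- d) * \<rho> powr (\<alpha> - ?n) = a / (A * \<rho>) powr d"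
    proof -
      have "a * A powr (- d) * \<rho> powr (- d) = a / (A * \<rho>) powr d"
        using A0 \<rho> by (simp add: powr_minus powr_mult field_simps)
      then show ?thesis by (simp add: d_def)
    qed
    ultimately show "\<exists>\<kappa>. a * A powr (- d) * \<rho> powr (\<alpha> - ?n) \<le> norm \<kappa> \<and>
       (\<forall>x\<in>cball (y + (A * \<rho>) *\<^sub>R w) (2 * ?n * \<rho>). \<forall>z\<in>cball y (2 * ?n * \<rho>).
          norm (K x z - \<kappa>) \<le> norm \<kappa> / 4)"
      using \<kappa>low unfolding x0_def by metis
  qed
qed

lemma kernel_continuous_off_diagonal:
  fixes K :: "real^'n::finite \<Rightarrow> real^'n \<Rightarrow> 'k::{real_normed_field,euclidean_space}"
  assumes K: "fractional_CZ_kernel \<alpha> K"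
  shows "continuous_on (- {x}) (K x)"
proof -
  obtain C \<delta> where \<delta>: "0 < \<delta>" and smooth: "\<And>x y h. x \<noteq> y \<Longrightarrow> norm h < norm (x - y) / 2 \<Longrightarrow>
     norm (K (x + h) y - K x y) + norm (K x (y + h) - K x y)
       \<le> C * norm h powr \<delta> / norm (x - y) powr (real CARD('n) - \<alpha> + \<delta>)"
    using K unfolding fractional_CZ_kernel_def by blast
  have "isCont (K x) z" if "z \<noteq> x" for z
    unfolding isCont_def
  proof (rule Lim_transform_bound[THEN Lim_null[THEN iffD2]])
    have "((\<lambda>y. C * norm (y - z) powr \<delta> / norm (x - z) powr (real CARD('n) - \<alpha> + \<delta>)) \<longlongrightarrow>
        C * norm (z - z) powr \<delta> / norm (x - z) powr (real CARD('n) - \<alpha> + \<delta>)) (at z)"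
      using \<delta> that by (intro tendsto_intros) (auto intro!: always_eventually)
    then show "((\<lambda>y. C * norm (y - z) powr \<delta> / norm (x - z) powr (real CARD('n) - \<alpha> + \<delta>)) \<longlongrightarrow> 0) (at z)"
      using \<delta> by simp
    have "norm (K x y - K x z) \<le> norm (C * norm (y - z) powr \<delta> / norm (x - z) powr (real CARD('n) - \<alpha> + \<delta>))"
      if "dist y z < norm (x - z) / 2" for y
    proof -
      have "norm (K x y - K x z) \<le> C * norm (y - z) powr \<delta> / norm (x - z) powr (real CARD('n) - \<alpha> + \<delta>)"
      proof -
        have "norm (K (x + (y - z)) z - K x z) + norm (K x (z + (y - z)) - K x z)
            \<le> C * norm (y - z) powr \<delta> / norm (x - z) powr (real CARD('n) - \<alpha> + \<delta>)"
          using that \<open>z \<noteq> x\<close> by (intro smooth) (auto simp: dist_norm)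
        moreover have "z + (y - z) = y" by simp
        ultimately show ?thesis using norm_ge_zero[of "K (x + (y - z)) z - K x z"] by (simp only:)
      qed
      also have "\<dots> \<le> norm \<dots>" by (simp only: real_norm_def abs_ge_self)
      finally show ?thesis .
    qed
    then show "\<forall>\<^sub>F y in at z. norm (K x y - K x z) \<le> norm (C * norm (y - z) powr \<delta> / norm (x - z) powr (real CARD('n) - \<alpha> + \<delta>))"
      unfolding eventually_at using that by (intro exI[of _ "norm (x - z) / 2"]) auto
  qed
  then show ?thesis by (auto intro: continuous_at_imp_continuous_on)
qed

lemma kernel_integrable:
  fixes K :: "real^'n::finite \<Rightarrow> real^'n \<Rightarrow> 'k::{real_normed_field,euclidean_space}"
  assumes K: "fractional_CZ_kernel \<alpha> K" and S: "compact S" "x \<notin> S" and U: "U \<in> sets lebesgue" "U \<subseteq> S"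
  shows "integrable lebesgue (\<lambda>z. K x z * (indicator U z *\<^sub>R b))"
proof -
  have cont: "continuous_on S (K x)"
    using kernel_continuous_off_diagonal[OF K] by (rule continuous_on_subset) (use S in auto)
  obtain B where B: "\<And>z. z \<in> S \<Longrightarrow> norm (K x z) \<le> B"
    using compact_imp_bounded[OF compact_continuous_image[OF cont S(1)]] by (auto simp: bounded_iff)
  have "(\<lambda>z. indicator S z *\<^sub>R K x z) \<in> borel_measurable borel"
    using cont S(1) by (intro borel_measurable_continuous_on_indicator) (auto simp: compact_imp_closed)
  then have m1: "(\<lambda>z. indicator S z *\<^sub>R K x z) \<in> borel_measurable lebesgue"
    by (simp add: measurable_completion)
  have m2: "(\<lambda>z. indicator U z *\<^sub>R b) \<in> borel_measurable lebesgue" using U(1) by measurable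
  have "integrable lebesgue (\<lambda>z. (indicator S z *\<^sub>R K x z) * (indicator U z *\<^sub>R b))"
  proof (rule integrableI_bounded_set)
    show "S \<in> sets lebesgue" "emeasure lebesgue S < \<infinity>"
      using lmeasurable_compact[OF S(1)] by (auto simp: fmeasurable_def)
    show "(\<lambda>z. (indicator S z *\<^sub>R K x z) * (indicator U z *\<^sub>R b)) \<in> borel_measurable lebesgue"
      using m1 m2 by (rule borel_measurable_times)
    show "AE z in lebesgue. z \<in> S \<longrightarrow> norm ((indicator S z *\<^sub>R K x z) * (indicator U z *\<^sub>R b)) \<le> max B 0 * norm b"
    proof (rule AE_I2, rule impI)
      fix z
      show "norm ((indicator S z *\<^sub>R K x z) * (indicator U z *\<^sub>R b)) \<le> max B 0 * norm b"
      proof (cases "z \<in> U")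
        case True
        then have "norm (K x z) * norm b \<le> max B 0 * norm b"
          using B[of z] U(2) by (intro mult_right_mono) auto
        then show ?thesis using True U(2) by (auto simp: norm_mult)
      qed simp
    qed
    show "AE z in lebesgue. z \<notin> S \<longrightarrow> (indicator S z *\<^sub>R K x z) * (indicator U z *\<^sub>R b) = 0" by simp
  qed
  also have "(\<lambda>z. (indicator S z *\<^sub>R K x z) * (indicator U z *\<^sub>R b)) = (\<lambda>z. K x z * (indicator U z *\<^sub>R b))"
    using U(2) by (auto simp: fun_eq_iff indicator_def)
  finally show ?thesis .
qed

lemma kernel_integral_approx:
  fixes K :: "real^'n::finite \<Rightarrow> real^'n \<Rightarrow> 'k::{real_normed_field,euclidean_space}"
  assumes K: "fractional_CZ_kernel \<alpha> K" and S: "compact S" "x \<notin> S" and U: "U \<in> sets lebesgue" "U \<subseteq> S"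
    and \<kappa>: "\<And>z. z \<in> S \<Longrightarrow> norm (K x z - \<kappa>) \<le> norm \<kappa> / 4"
  shows "norm ((\<integral>z. K x z * (indicator U z *\<^sub>R b) \<partial>lebesgue) - measure lebesgue U *\<^sub>R (\<kappa> * b))
    \<le> norm \<kappa> / 4 * norm b * measure lebesgue U"
proof -
  have Ul: "U \<in> lmeasurable" using lmeasurable_compact[OF S(1)] U by (auto intro: fmeasurableI2)
  have i1: "integrable lebesgue (\<lambda>z. K x z * (indicator U z *\<^sub>R b))"
    by (rule kernel_integrable[OF K S U])
  have iU: "integrable lebesgue (indicator U :: _ \<Rightarrow> real)"
    using Ul by (intro integrable_real_indicator) (auto simp: fmeasurable_def)
  have i2: "integrable lebesgue (\<lambda>z. indicator U z *\<^sub>R (\<kappa> * b))"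
    using iU by (rule integrable_scaleR_left)
  have "(\<integral>z. indicator U z *\<^sub>R (\<kappa> * b) \<partial>lebesgue) = measure lebesgue U *\<^sub>R (\<kappa> * b)"
    using iU by simp
  then have "(\<integral>z. K x z * (indicator U z *\<^sub>R b) \<partial>lebesgue) - measure lebesgue U *\<^sub>R (\<kappa> * b)
      = (\<integral>z. K x z * (indicator U z *\<^sub>R b) - indicator U z *\<^sub>R (\<kappa> * b) \<partial>lebesgue)"
    using i1 i2 by simp
  also have "norm \<dots> \<le> (\<integral>z. norm (K x z * (indicator U z *\<^sub>R b) - indicator U z *\<^sub>R (\<kappa> * b)) \<partial>lebesgue)"
    by (rule integral_norm_bound)
  also have "\<dots> \<le> (\<integral>z. indicator U z * (norm \<kappa> / 4 * norm b) \<partial>lebesgue)"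
  proof (rule integral_mono)
    show "integrable lebesgue (\<lambda>z. norm (K x z * (indicator U z *\<^sub>R b) - indicator U z *\<^sub>R (\<kappa> * b)))"
      using i1 i2 by auto
    show "integrable lebesgue (\<lambda>z. indicator U z * (norm \<kappa> / 4 * norm b))" using iU by auto
    fix z
    have "norm (K x z * b - \<kappa> * b) \<le> norm \<kappa> / 4 * norm b" if "z \<in> U"
    proof -
      have "norm (K x z - \<kappa>) * norm b \<le> norm \<kappa> / 4 * norm b"
        using \<kappa>[of z] U(2) that by (intro mult_right_mono) auto
      then show ?thesis by (simp only: left_diff_distrib[symmetric] norm_mult)
    qed
    then show "norm (K x z * (indicator U z *\<^sub>R b) - indicator U z *\<^sub>R (\<kappa> * b)) \<le> indicator U z * (norm \<kappa> / 4 * norm b)"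
      by (cases "z \<in> U") auto
  qed
  also have "\<dots> = norm \<kappa> / 4 * norm b * measure lebesgue U" using Ul by simp
  finally show ?thesis .
qed

text \<open>
  Step functions with bounded sets lie in every Lebesgue space with finite exponent, so the kernel representation of \<open>T\<close>
  applies to them whichever exponent it was given for.
\<close>

lemma operator_on_step_functions:
  fixes K :: "real^'n::finite \<Rightarrow> real^'n \<Rightarrow> 'k::{real_normed_field,euclidean_space}"
  assumes T: "fractional_CZ_operator \<alpha> K T" and J: "finite J"
    and S: "\<And>j. j \<in> J \<Longrightarrow> compact (S j)" and U: "\<And>j. j \<in> J \<Longrightarrow> U j \<in> sets lebesgue" "\<And>j. j \<in> J \<Longrightarrow> U j \<subseteq> S j"
  shows "AE x in lebesgue. x \<notin> (\<Union>j\<in>J. S j) \<longrightarrow>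
    T (\<lambda>z. \<Sum>j\<in>J. indicator (U j) z *\<^sub>R b j) x = (\<Sum>j\<in>J. \<integral>z. K x z * (indicator (U j) z *\<^sub>R b j) \<partial>lebesgue)"
proof -
  define f where "f z = (\<Sum>j\<in>J. indicator (U j) z *\<^sub>R b j)" for z
  define W where "W = (\<Union>j\<in>J. S j)"
  have W: "compact W" unfolding W_def using J S by (intro compact_UN) auto
  have K: "fractional_CZ_kernel \<alpha> K" using T by (simp add: fractional_CZ_operator_def)
  obtain r where r: "1 < r" and rep: "\<And>f. f \<in> Lp_space r \<Longrightarrow> compact (fun_supp f) \<Longrightarrow>
      AE x in lebesgue. x \<notin> fun_supp f \<longrightarrow> T f x = (\<integral>y. K x y * f y \<partial>lebesgue)"
    using T unfolding fractional_CZ_operator_def by blast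
  have fm: "f \<in> borel_measurable lebesgue"
    unfolding f_def using U(1) by (intro borel_measurable_sum borel_measurable_scaleR) auto
  have f0: "f z = 0" if "z \<notin> W" for z
  proof -
    have "z \<notin> U j" if "j \<in> J" for j using U(2)[OF that] that \<open>z \<notin> W\<close> by (auto simp: W_def)
    then show ?thesis unfolding f_def by (intro sum.neutral) auto
  qed
  define M where "M = (\<Sum>j\<in>J. norm (b j))"
  have M: "norm (f z) \<le> M" for z
    unfolding f_def M_def by (rule order.trans[OF norm_sum]) (auto intro!: sum_mono simp: indicator_def)
  have "integrable lebesgue (\<lambda>x. norm (f x) powr r)"
  proof (rule integrableI_bounded_set)
    show "W \<in> sets lebesgue" "emeasure lebesgue W < \<infinity>"
      using lmeasurable_compact[OF W] by (auto simp: fmeasurable_def)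
    show "(\<lambda>x. norm (f x) powr r) \<in> borel_measurable lebesgue" using fm by measurable
    show "AE z in lebesgue. z \<in> W \<longrightarrow> norm (norm (f z) powr r) \<le> M powr r"
      using M r by (intro AE_I2 impI) (auto intro!: powr_mono2)
    show "AE z in lebesgue. z \<notin> W \<longrightarrow> norm (f z) powr r = 0" using f0 r by auto
  qed
  then have fL: "f \<in> Lp_space r" using fm by (simp add: Lp_space_def)
  have supp: "fun_supp f \<subseteq> W"
    unfolding fun_supp_def using f0 W by (intro closure_minimal) (auto intro: compact_imp_closed)
  then have "compact (fun_supp f)"
    using W supp by (auto simp: fun_supp_def compact_eq_bounded_closed intro: bounded_subset[of W])
  from rep[OF fL this] show ?thesis
  proof (rule eventually_mono, intro impI)
    fix x
    assume *: "x \<notin> fun_supp f \<longrightarrow> T f x = (\<integral>y. K x y * f y \<partial>lebesgue)" and x: "x \<notin> (\<Union>j\<in>J. S j)"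
    then have "T f x = (\<integral>y. K x y * f y \<partial>lebesgue)" using supp by (auto simp: W_def)
    also have "\<dots> = (\<integral>y. (\<Sum>j\<in>J. K x y * (indicator (U j) y *\<^sub>R b j)) \<partial>lebesgue)"
      by (simp add: f_def sum_distrib_left)
    also have "\<dots> = (\<Sum>j\<in>J. \<integral>z. K x z * (indicator (U j) z *\<^sub>R b j) \<partial>lebesgue)"
    proof (rule Bochner_Integration.integral_sum)
      fix j assume j: "j \<in> J"
      then show "integrable lebesgue (\<lambda>z. K x z * (indicator (U j) z *\<^sub>R b j))"
        using x by (intro kernel_integrable[OF K S[OF j] _ U(1)[OF j] U(2)[OF j]]) auto
    qed
    finally show "T (\<lambda>z. \<Sum>j\<in>J. indicator (U j) z *\<^sub>R b j) x = (\<Sum>j\<in>J. \<integral>z. K x z * (indicator (U j) z *\<^sub>R b j) \<partial>lebesgue)"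
      by (simp add: f_def[abs_def])
  qed
qed

section \<open>Modulars and norms with variable exponents\<close>

text \<open>
  The real reciprocal of the exponent is \<open>0\<close> where the exponent is infinite: \<open>real_of_ereal\<close> sends \<open>\<infinity>\<close> to \<open>0\<close>, and
  \<open>inverse 0 = 0\<close>. The relation between \<open>p\<close> and \<open>q\<close> is linear in these reciprocals.
\<close>

definition recip_exponent :: "(real^'n \<Rightarrow> ereal) \<Rightarrow> real^'n \<Rightarrow> real" where
  "recip_exponent p x = inverse (real_of_ereal (p x))"

lemma recip_exponent_bounds:
  assumes "exponent_function p"
  shows "0 \<le> recip_exponent p x" "recip_exponent p x \<le> 1"
    and "x \<in> Omega_inf p \<longleftrightarrow> recip_exponent p x = 0"
    and "real_of_ereal (p x) = 1 / recip_exponent p x"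
proof -
  have "1 \<le> p x" using assms by (simp add: exponent_function_def)
  then show "0 \<le> recip_exponent p x" "recip_exponent p x \<le> 1"
    "x \<in> Omega_inf p \<longleftrightarrow> recip_exponent p x = 0" "real_of_ereal (p x) = 1 / recip_exponent p x"
    unfolding recip_exponent_def Omega_inf_def
    by (cases "p x"; auto simp: inverse_le_1_iff divide_inverse)+
qed

lemma recip_exponent_measurable:
  assumes "exponent_function p"
  shows "recip_exponent p \<in> borel_measurable lebesgue"
proof -
  have [measurable]: "p \<in> borel_measurable lebesgue" using assms by (simp add: exponent_function_def)
  show ?thesis unfolding recip_exponent_def[abs_def] by measurable
qed

lemma Omega_inf_measurable:
  assumes "exponent_function p"
  shows "Omega_inf p \<in> sets lebesgue"
proof -
  have [measurable]: "p \<in> borel_measurable lebesgue" using assms by (simp add: exponent_function_def)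
  have "{x \<in> space lebesgue. p x = \<infinity>} \<in> sets lebesgue" by measurable
  then show ?thesis by (simp add: Omega_inf_def)
qed

lemma recip_exponent_diff:
  assumes "exponent_function p" "exponent_function q" "1 / p x - 1 / q x = ereal c"
  shows "recip_exponent p x - recip_exponent q x = c"
proof -
  have "1 \<le> p x" "1 \<le> q x" using assms by (simp_all add: exponent_function_def)
  then show ?thesis using assms(3) unfolding recip_exponent_def
    by (cases "p x"; cases "q x") (auto simp: divide_inverse one_ereal_def)
qed

lemma step_function_value:
  fixes b :: "'i \<Rightarrow> 'b::real_vector"
  assumes J: "finite J" and disj: "\<And>i j. i \<in> J \<Longrightarrow> j \<in> J \<Longrightarrow> i \<noteq> j \<Longrightarrow> U i \<inter> U j = {}"
    and j: "j \<in> J" "x \<in> U j"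
  shows "(\<Sum>i\<in>J. indicator (U i) x *\<^sub>R b i) = b j"
proof -
  have "(\<Sum>i\<in>J. indicator (U i) x *\<^sub>R b i) = (\<Sum>i\<in>J. if i = j then b j else 0)"
    using disj j by (intro sum.cong refl) (auto simp: indicator_def)
  then show ?thesis using J j by simp
qed

text \<open>
  The points with infinite exponent enter the modular through a supremum instead of an integral, hence the separate bound
  \<open>B\<close> for them.
\<close>

lemma modular_step_le:
  fixes b :: "nat \<Rightarrow> 'k::{real_normed_field,euclidean_space}" and p :: "real^'n::finite \<Rightarrow> ereal"
  assumes p: "exponent_function p" and J: "finite J"
    and U: "\<And>j. j \<in> J \<Longrightarrow> U j \<in> lmeasurable"
    and disj: "\<And>i j. i \<in> J \<Longrightarrow> j \<in> J \<Longrightarrow> i \<noteq> j \<Longrightarrow> U i \<inter> U j = {}"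
    and B: "0 \<le> B" and a: "\<And>j. j \<in> J \<Longrightarrow> 0 \<le> a j"
    and fin: "\<And>j x. j \<in> J \<Longrightarrow> x \<in> U j \<Longrightarrow> 0 < recip_exponent p x \<Longrightarrow> norm (b j) powr (1 / recip_exponent p x) \<le> a j"
    and inf: "\<And>j x. j \<in> J \<Longrightarrow> x \<in> U j \<Longrightarrow> recip_exponent p x = 0 \<Longrightarrow> norm (b j) \<le> B"
    and total: "(\<Sum>j\<in>J. a j * measure lebesgue (U j)) + B \<le> 1"
  shows "modular p (\<lambda>x. \<Sum>j\<in>J. indicator (U j) x *\<^sub>R b j) \<le> 1"
proof -
  define f where "f x = (\<Sum>j\<in>J. indicator (U j) x *\<^sub>R b j)" for x
  have fval: "f x = b j" if "j \<in> J" "x \<in> U j" for j x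
    unfolding f_def by (rule step_function_value[where U = U and b = b, OF J _ that]) (rule disj)
  have f0: "f x = 0" if "\<And>j. j \<in> J \<Longrightarrow> x \<notin> U j" for x
    unfolding f_def using that by (intro sum.neutral) auto
  have fm: "f \<in> borel_measurable lebesgue"
    unfolding f_def using U by (intro borel_measurable_sum borel_measurable_scaleR) auto
  have "(\<integral>\<^sup>+ x \<in> - Omega_inf p. ennreal (norm (f x) powr real_of_ereal (p x)) \<partial>lebesgue)
      \<le> (\<integral>\<^sup>+ x. (\<Sum>j\<in>J. ennreal (a j) * indicator (U j) x) \<partial>lebesgue)"
  proof (rule nn_integral_mono)
    fix x
    show "ennreal (norm (f x) powr real_of_ereal (p x)) * indicator (- Omega_inf p) x \<le> (\<Sum>j\<in>J. ennreal (a j) * indicator (U j) x)"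
    proof (cases "x \<notin> Omega_inf p \<and> (\<exists>j\<in>J. x \<in> U j)")
      case True
      then obtain j where j: "j \<in> J" "x \<in> U j" by blast
      have r: "0 < recip_exponent p x" using True recip_exponent_bounds(1,3)[OF p, of x] by auto
      have "ennreal (norm (f x) powr real_of_ereal (p x)) \<le> ennreal (a j)"
        using fin[OF j r] by (intro ennreal_leI) (simp add: fval[OF j] recip_exponent_bounds(4)[OF p])
      also have "ennreal (a j) = ennreal (a j) * indicator (U j) x" using j by simp
      also have "\<dots> \<le> (\<Sum>j\<in>J. ennreal (a j) * indicator (U j) x)"
        using J j by (intro member_le_sum) auto
      finally show ?thesis using True by simp
    next
      case False
      then show ?thesis using f0[of x] by (auto simp: indicator_def)
    qed
  qed
  also have "\<dots> = (\<Sum>j\<in>J. \<integral>\<^sup>+ x. ennreal (a j) * indicator (U j) x \<partial>lebesgue)"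
    using U by (intro nn_integral_sum) auto
  also have "\<dots> = (\<Sum>j\<in>J. ennreal (a j * measure lebesgue (U j)))"
    using U a by (intro sum.cong refl)
      (simp add: nn_integral_cmult_indicator fmeasurableD emeasure_eq_measure2 ennreal_mult del: emeasure_completion)
  also have "\<dots> = ennreal (\<Sum>j\<in>J. a j * measure lebesgue (U j))"
    using a by (intro sum_ennreal) auto
  finally have 1: "(\<integral>\<^sup>+ x \<in> - Omega_inf p. ennreal (norm (f x) powr real_of_ereal (p x)) \<partial>lebesgue)
      \<le> ennreal (\<Sum>j\<in>J. a j * measure lebesgue (U j))" .
  have 2: "esssup (restrict_space lebesgue (Omega_inf p)) (\<lambda>x. ennreal (norm (f x))) \<le> ennreal B"
  proof (rule esssup_I)
    show "(\<lambda>x. ennreal (norm (f x))) \<in> borel_measurable (restrict_space lebesgue (Omega_inf p))"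
      using fm by (intro measurable_restrict_space1) measurable
    show "AE x in restrict_space lebesgue (Omega_inf p). ennreal (norm (f x)) \<le> ennreal B"
    proof (rule AE_I2)
      fix x assume "x \<in> space (restrict_space lebesgue (Omega_inf p))"
      then have x: "recip_exponent p x = 0"
        using recip_exponent_bounds(3)[OF p] by (simp add: space_restrict_space)
      show "ennreal (norm (f x)) \<le> ennreal B"
      proof (cases "\<exists>j\<in>J. x \<in> U j")
        case True
        then show ?thesis using inf x fval by (auto intro!: ennreal_leI)
      next
        case False
        then show ?thesis using f0[of x] by auto
      qed
    qed
  qed
  have "modular p f \<le> ennreal (\<Sum>j\<in>J. a j * measure lebesgue (U j)) + ennreal B"
    unfolding modular_def using 1 2 by (rule add_mono)
  also have "\<dots> = ennreal ((\<Sum>j\<in>J. a j * measure lebesgue (U j)) + B)"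
    using a B by (intro ennreal_plus[symmetric] sum_nonneg) auto
  also have "\<dots> \<le> 1" using total by (simp add: ennreal_le_1)
  finally show ?thesis by (simp add: f_def[abs_def])
qed

lemma modular_ge_sum:
  fixes g :: "real^'n::finite \<Rightarrow> 'k::{real_normed_field,euclidean_space}"
  assumes q: "exponent_function q" and J: "finite J"
    and U: "\<And>j. j \<in> J \<Longrightarrow> U j \<in> lmeasurable"
    and disj: "\<And>i j. i \<in> J \<Longrightarrow> j \<in> J \<Longrightarrow> i \<noteq> j \<Longrightarrow> U i \<inter> U j = {}"
    and a: "\<And>j. j \<in> J \<Longrightarrow> 0 \<le> a j"
    and low: "\<And>j. j \<in> J \<Longrightarrow> AE x in lebesgue. x \<in> U j \<longrightarrow>
      0 < recip_exponent q x \<and> a j \<le> norm (g x) powr (1 / recip_exponent q x)"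
  shows "ennreal (\<Sum>j\<in>J. a j * measure lebesgue (U j)) \<le> modular q g"
proof -
  have "ennreal (\<Sum>j\<in>J. a j * measure lebesgue (U j)) = (\<Sum>j\<in>J. ennreal (a j * measure lebesgue (U j)))"
    using a by (intro sum_ennreal[symmetric]) auto
  also have "\<dots> = (\<Sum>j\<in>J. \<integral>\<^sup>+ x. ennreal (a j) * indicator (U j) x \<partial>lebesgue)"
    using U a by (intro sum.cong refl)
      (simp add: nn_integral_cmult_indicator fmeasurableD emeasure_eq_measure2 ennreal_mult del: emeasure_completion)
  also have "\<dots> = (\<integral>\<^sup>+ x. (\<Sum>j\<in>J. ennreal (a j) * indicator (U j) x) \<partial>lebesgue)"
    using U by (intro nn_integral_sum[symmetric]) auto
  also have "\<dots> \<le> (\<integral>\<^sup>+ x \<in> - Omega_inf q. ennreal (norm (g x) powr real_of_ereal (q x)) \<partial>lebesgue)"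
  proof (rule nn_integral_mono_AE)
    have "AE x in lebesgue. \<forall>j\<in>J. x \<in> U j \<longrightarrow>
        0 < recip_exponent q x \<and> a j \<le> norm (g x) powr (1 / recip_exponent q x)"
      using J low by (intro AE_finite_allI) auto
    then show "AE x in lebesgue. (\<Sum>j\<in>J. ennreal (a j) * indicator (U j) x)
        \<le> ennreal (norm (g x) powr real_of_ereal (q x)) * indicator (- Omega_inf q) x"
    proof (rule eventually_mono)
      fix x assume *: "\<forall>j\<in>J. x \<in> U j \<longrightarrow> 0 < recip_exponent q x \<and> a j \<le> norm (g x) powr (1 / recip_exponent q x)"
      show "(\<Sum>j\<in>J. ennreal (a j) * indicator (U j) x)
        \<le> ennreal (norm (g x) powr real_of_ereal (q x)) * indicator (- Omega_inf q) x"
      proof (cases "\<exists>j\<in>J. x \<in> U j")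
        case True
        then obtain j where j: "j \<in> J" "x \<in> U j" by blast
        have "(\<Sum>i\<in>J. ennreal (a i) * indicator (U i) x) = (\<Sum>i\<in>J. if i = j then ennreal (a j) else 0)"
          using disj j by (intro sum.cong refl) (auto simp: indicator_def)
        also have "\<dots> = ennreal (a j)" using J j by simp
        finally show ?thesis
          using * j recip_exponent_bounds(3,4)[OF q, of x] by (auto intro!: ennreal_leI)
      next
        case False
        then have "(\<Sum>i\<in>J. ennreal (a i) * indicator (U i) x) = 0" by (intro sum.neutral) auto
        then show ?thesis by simp
      qed
    qed
  qed
  also have "\<dots> \<le> modular q g" by (simp add: modular_def)
  finally show ?thesis .
qed

text \<open>
  The indicator function of a set \<open>U\<close> of measure at most \<open>1\<close> has norm at least \<open>measure lebesgue U powr m\<close> when \<open>1 / q \<le> m\<close> on it.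
  Both parts of the modular are used: if \<open>q\<close> is infinite on a non-null part of \<open>U\<close>, the supremum alone decides, and otherwise the
  integral does.
\<close>

lemma norm_ge_on_set:
  fixes g :: "real^'n::finite \<Rightarrow> 'k::{real_normed_field,euclidean_space}"
  assumes q: "exponent_function q" and g: "g \<in> borel_measurable lebesgue"
    and U: "U \<in> lmeasurable" "0 < measure lebesgue U" "measure lebesgue U \<le> 1"
    and m: "0 \<le> m" "\<And>x. x \<in> U \<Longrightarrow> recip_exponent q x \<le> m"
    and H: "0 \<le> H" "AE x in lebesgue. x \<in> U \<longrightarrow> H \<le> norm (g x)"
    and c: "0 < c" "modular q (\<lambda>x. g x /\<^sub>R c) \<le> 1"
  shows "H * measure lebesgue U powr m \<le> c"
proof (rule ccontr)
  define V where "V = measure lebesgue U"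
  define \<tau> where "\<tau> = H / c"
  assume "\<not> ?thesis"
  then have "c < H * V powr m" by (simp add: V_def)
  then have \<tau>V: "1 < \<tau> * V powr m" using c(1) by (simp add: \<tau>_def field_simps)
  have V: "0 < V" "V \<le> 1" using U by (auto simp: V_def)
  have Vm: "0 < V powr m" "V powr m \<le> 1" using V m(1) by (auto intro: powr_le1)
  have "0 \<le> \<tau>" using H c by (simp add: \<tau>_def)
  then have "\<tau> * V powr m \<le> \<tau>" using Vm by (intro mult_left_le) auto
  then have \<tau>1: "1 < \<tau>" using \<tau>V by linarith
  have g\<tau>: "AE x in lebesgue. x \<in> U \<longrightarrow> \<tau> \<le> norm (g x /\<^sub>R c)"
    using H(2)
  proof (rule eventually_mono, intro impI)
    fix x assume "x \<in> U \<longrightarrow> H \<le> norm (g x)" "x \<in> U"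
    then show "\<tau> \<le> norm (g x /\<^sub>R c)" using c(1) by (simp add: \<tau>_def divide_right_mono divide_inverse mult.commute)
  qed
  have \<Omega>: "Omega_inf q \<in> sets lebesgue" by (rule Omega_inf_measurable[OF q])
  have "esssup (restrict_space lebesgue (Omega_inf q)) (\<lambda>x. ennreal (norm (g x /\<^sub>R c))) \<le> 1"
    using order.trans[OF add_increasing[OF zero_le order_refl] c(2)[unfolded modular_def]] .
  then have "AE x in restrict_space lebesgue (Omega_inf q). ennreal (norm (g x /\<^sub>R c)) \<le> 1"
    by (intro eventually_mono[OF esssup_AE]) (rule order.trans)
  then have "AE x in lebesgue. x \<in> Omega_inf q \<longrightarrow> ennreal (norm (g x /\<^sub>R c)) \<le> 1"
    using \<Omega> by (subst (asm) AE_restrict_space_iff) auto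
  then have null: "AE x in lebesgue. \<not> (x \<in> U \<and> x \<in> Omega_inf q)"
    using g\<tau> by eventually_elim (use \<tau>1 in \<open>auto simp: ennreal_le_1\<close>)
  have mpos: "0 < m"
  proof (rule ccontr)
    assume "\<not> 0 < m"
    then have "U \<subseteq> Omega_inf q"
      using m recip_exponent_bounds(1,3)[OF q] by (force intro: antisym)
    then have "AE x in lebesgue. x \<notin> U" using null by (auto elim!: eventually_mono)
    then have "U \<in> null_sets lebesgue" using U(1) by (subst (asm) AE_iff_null_sets[symmetric]) (auto simp: fmeasurableD)
    then have "measure lebesgue U = 0" by (rule measure_eq_0_null_sets)
    then show False using U(2) by simp
  qed
  have "ennreal (\<Sum>j\<in>{0::nat}. \<tau> powr (1 / m) * measure lebesgue U) \<le> modular q (\<lambda>x. g x /\<^sub>R c)"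
  proof (rule modular_ge_sum[OF q, where U = "\<lambda>_. U" and a = "\<lambda>_. \<tau> powr (1 / m)"])
    fix j
    show "AE x in lebesgue. x \<in> U \<longrightarrow> 0 < recip_exponent q x \<and> \<tau> powr (1 / m) \<le> norm (g x /\<^sub>R c) powr (1 / recip_exponent q x)"
      using g\<tau> null
    proof (eventually_elim, intro impI)
      fix x assume *: "x \<in> U \<longrightarrow> \<tau> \<le> norm (g x /\<^sub>R c)" "\<not> (x \<in> U \<and> x \<in> Omega_inf q)" "x \<in> U"
      have r: "0 < recip_exponent q x" "recip_exponent q x \<le> m"
        using * m(2) recip_exponent_bounds(1,3)[OF q, of x] by force+
      have "\<tau> powr (1 / m) \<le> \<tau> powr (1 / recip_exponent q x)"
        using r \<tau>1 mpos by (intro powr_mono frac_le) auto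
      also have "\<dots> \<le> norm (g x /\<^sub>R c) powr (1 / recip_exponent q x)"
        using * r \<tau>1 by (intro powr_mono2) auto
      finally show "0 < recip_exponent q x \<and> \<tau> powr (1 / m) \<le> norm (g x /\<^sub>R c) powr (1 / recip_exponent q x)"
        using r by simp
    qed
  qed (use U in auto)
  from order.trans[OF this c(2)] have "ennreal (\<tau> powr (1 / m) * V) \<le> 1" by (simp add: V_def)
  then have "\<tau> powr (1 / m) * V \<le> 1" by (simp add: ennreal_le_1)
  moreover have "1 < \<tau> powr (1 / m) * V"
  proof -
    have "1 powr (1 / m) < (\<tau> * V powr m) powr (1 / m)"
      using \<tau>V mpos by (intro powr_less_mono2) auto
    also have "\<dots> = \<tau> powr (1 / m) * V"
      using \<tau>1 V mpos by (simp add: powr_mult powr_powr)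
    finally show ?thesis by simp
  qed
  ultimately show False by simp
qed

text \<open>
  The norm inequality in the form in which it is used: every lower bound for the admissible scalings of \<open>T f\<close>, for
  \<open>f\<close> in the unit ball of the modular, is at most the operator constant.
\<close>

lemma bounded_var_Lp_unit_ball:
  fixes T :: "(real^'n::finite \<Rightarrow> 'k) \<Rightarrow> (real^'n \<Rightarrow> 'k::{real_normed_field,euclidean_space})"
  assumes "bounded_var_Lp p q T"
  obtains C where "\<And>f. f \<in> borel_measurable lebesgue \<Longrightarrow> modular p f \<le> 1 \<Longrightarrow> T f \<in> borel_measurable lebesgue"
    "\<And>f c0. f \<in> borel_measurable lebesgue \<Longrightarrow> modular p f \<le> 1 \<Longrightarrow>
      (\<And>c. 0 < c \<Longrightarrow> modular q (\<lambda>x. T f x /\<^sub>R c) \<le> 1 \<Longrightarrow> c0 \<le> c) \<Longrightarrow> c0 \<le> C"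
proof -
  obtain C where C: "\<And>f. f \<in> var_Lp p \<Longrightarrow> T f \<in> var_Lp q \<and> var_norm q (T f) \<le> ennreal C * var_norm p f"
    using assms unfolding bounded_var_Lp_def by blast
  have mem: "f \<in> var_Lp p" if "f \<in> borel_measurable lebesgue" "modular p f \<le> 1" for f :: "real^'n \<Rightarrow> 'k"
    using that unfolding var_Lp_def by (auto intro!: exI[of _ 1] simp: order.strict_trans1)
  show thesis
  proof (rule that[of "max C 0"])
    fix f :: "real^'n \<Rightarrow> 'k" and c0
    assume f: "f \<in> borel_measurable lebesgue" "modular p f \<le> 1"
    then show "T f \<in> borel_measurable lebesgue" using C[OF mem] by (simp add: var_Lp_def)
    assume low: "\<And>c. 0 < c \<Longrightarrow> modular q (\<lambda>x. T f x /\<^sub>R c) \<le> 1 \<Longrightarrow> c0 \<le> c"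
    have "ennreal c0 \<le> var_norm q (T f)"
      unfolding var_norm_def using low by (intro Inf_greatest) (auto intro!: ennreal_leI)
    also have "\<dots> \<le> ennreal C * var_norm p f" using C[OF mem[OF f]] by simp
    also have "\<dots> \<le> ennreal C * ennreal 1"
      unfolding var_norm_def using f(2) by (intro mult_left_mono Inf_lower) (auto intro!: exI[of _ 1])
    finally have "ennreal c0 \<le> ennreal C" by simp
    also have "\<dots> \<le> ennreal (max C 0)" by (intro ennreal_leI) simp
    finally have "ennreal c0 \<le> ennreal (max C 0)" .
    then show "c0 \<le> max C 0" by (subst (asm) ennreal_le_iff) auto
  qed
qed

section \<open>Geometry and exponent inequalities for the clusters\<close>

text \<open>
  Replacing the kernel by a constant \<open>\<kappa> j\<close> on each step costs at most a quarter of the sum of the moduli, so the size of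
  \<open>T f\<close> is decided by the sum of the \<open>\<kappa> j * b j\<close>, where the phases of the \<open>b j\<close> can be chosen.
\<close>

lemma operator_lower_bound:
  fixes K :: "real^'n::finite \<Rightarrow> real^'n \<Rightarrow> 'k::{real_normed_field,euclidean_space}"
  assumes T: "fractional_CZ_operator \<alpha> K T" and J: "finite J"
    and S: "\<And>j. j \<in> J \<Longrightarrow> compact (S j)" and U: "\<And>j. j \<in> J \<Longrightarrow> U j \<in> sets lebesgue" "\<And>j. j \<in> J \<Longrightarrow> U j \<subseteq> S j"
    and X: "\<And>x j. x \<in> X \<Longrightarrow> j \<in> J \<Longrightarrow> x \<notin> S j"
    and \<kappa>: "\<And>x j z. x \<in> X \<Longrightarrow> j \<in> J \<Longrightarrow> z \<in> S j \<Longrightarrow> norm (K x z - \<kappa> j) \<le> norm (\<kappa> j) / 4"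
  shows "AE x in lebesgue. x \<in> X \<longrightarrow>
    norm (\<Sum>j\<in>J. measure lebesgue (U j) *\<^sub>R (\<kappa> j * b j)) - (\<Sum>j\<in>J. norm (\<kappa> j) * norm (b j) * measure lebesgue (U j)) / 4
      \<le> norm (T (\<lambda>z. \<Sum>j\<in>J. indicator (U j) z *\<^sub>R b j) x)"
proof -
  have rep: "AE x in lebesgue. x \<notin> (\<Union>j\<in>J. S j) \<longrightarrow>
    T (\<lambda>z. \<Sum>j\<in>J. indicator (U j) z *\<^sub>R b j) x = (\<Sum>j\<in>J. \<integral>z. K x z * (indicator (U j) z *\<^sub>R b j) \<partial>lebesgue)"
    by (rule operator_on_step_functions[OF T J S U])
  show ?thesis
    using rep
proof (rule eventually_mono, intro impI)
  fix x
  have K: "fractional_CZ_kernel \<alpha> K" using T by (simp add: fractional_CZ_operator_def)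
  let ?I = "\<lambda>j. \<integral>z. K x z * (indicator (U j) z *\<^sub>R b j) \<partial>lebesgue"
  let ?a = "\<lambda>j. measure lebesgue (U j) *\<^sub>R (\<kappa> j * b j)"
  assume *: "x \<notin> (\<Union>j\<in>J. S j) \<longrightarrow> T (\<lambda>z. \<Sum>j\<in>J. indicator (U j) z *\<^sub>R b j) x = (\<Sum>j\<in>J. ?I j)" and x: "x \<in> X"
  have Tx: "T (\<lambda>z. \<Sum>j\<in>J. indicator (U j) z *\<^sub>R b j) x = (\<Sum>j\<in>J. ?I j)" using * X[OF x] by blast
  have "norm ((\<Sum>j\<in>J. ?I j) - (\<Sum>j\<in>J. ?a j)) \<le> (\<Sum>j\<in>J. norm (?I j - ?a j))"
    unfolding sum_subtractf[symmetric] by (rule norm_sum)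
  also have "\<dots> \<le> (\<Sum>j\<in>J. norm (\<kappa> j) / 4 * norm (b j) * measure lebesgue (U j))"
  proof (rule sum_mono)
    fix j assume j: "j \<in> J"
    show "norm (?I j - ?a j) \<le> norm (\<kappa> j) / 4 * norm (b j) * measure lebesgue (U j)"
      by (rule kernel_integral_approx[OF K S[OF j] X[OF x j] U(1)[OF j] U(2)[OF j] \<kappa>[OF x j]])
  qed
  also have "\<dots> = (\<Sum>j\<in>J. norm (\<kappa> j) * norm (b j) * measure lebesgue (U j)) / 4"
    by (simp add: sum_divide_distrib)
  finally have "norm ((\<Sum>j\<in>J. ?I j) - (\<Sum>j\<in>J. ?a j)) \<le> (\<Sum>j\<in>J. norm (\<kappa> j) * norm (b j) * measure lebesgue (U j)) / 4" .
  moreover have "norm (\<Sum>j\<in>J. ?a j) \<le> norm (\<Sum>j\<in>J. ?I j) + norm ((\<Sum>j\<in>J. ?I j) - (\<Sum>j\<in>J. ?a j))"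
    by (subst norm_minus_commute) (rule norm_triangle_sub)
  ultimately show "norm (\<Sum>j\<in>J. ?a j) - (\<Sum>j\<in>J. norm (\<kappa> j) * norm (b j) * measure lebesgue (U j)) / 4
      \<le> norm (T (\<lambda>z. \<Sum>j\<in>J. indicator (U j) z *\<^sub>R b j) x)"
    unfolding Tx by linarith
qed
qed

text \<open>
  For two scales with ratio at least \<open>2\<close>, the distance of the centres is at least \<open>A * \<rho> / 2\<close>, and the radii sum up to at most \<open>3 * n * \<rho>\<close>.
\<close>

lemma cluster_balls_apart:
  fixes y w :: "'a::real_inner"
  assumes "norm w = 1" "8 * n < A" "0 < \<rho>'" "2 * \<rho>' \<le> \<rho>" "0 \<le> n"
  shows "cball (y + (A * \<rho>') *\<^sub>R w) (2 * n * \<rho>') \<inter> cball (y + (A * \<rho>) *\<^sub>R w) (2 * n * \<rho>) = {}"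
proof (rule ccontr)
  assume "\<not> ?thesis"
  then obtain x where "dist (y + (A * \<rho>') *\<^sub>R w) x \<le> 2 * n * \<rho>'" "dist (y + (A * \<rho>) *\<^sub>R w) x \<le> 2 * n * \<rho>"
    by auto
  then have d: "dist (y + (A * \<rho>) *\<^sub>R w) (y + (A * \<rho>') *\<^sub>R w) \<le> 2 * n * \<rho>' + 2 * n * \<rho>"
    using dist_triangle2[of "y + (A * \<rho>) *\<^sub>R w" "y + (A * \<rho>') *\<^sub>R w" x] by linarith
  have "(y + (A * \<rho>) *\<^sub>R w) - (y + (A * \<rho>') *\<^sub>R w) = (A * (\<rho> - \<rho>')) *\<^sub>R w"
    by (simp add: algebra_simps)
  then have "dist (y + (A * \<rho>) *\<^sub>R w) (y + (A * \<rho>') *\<^sub>R w) = A * (\<rho> - \<rho>')"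
    using assms by (simp add: dist_norm)
  moreover have "A * (\<rho> / 2) \<le> A * (\<rho> - \<rho>')" using assms by (intro mult_left_mono) auto
  moreover have "8 * n * (\<rho> / 2) < A * (\<rho> / 2)" using assms by (intro mult_strict_right_mono) auto
  moreover have "2 * n * \<rho>' \<le> n * \<rho>" using mult_left_mono[OF assms(4,5)] by (simp add: algebra_simps)
  moreover have "0 \<le> n * \<rho>" using assms by simp
  ultimately show False using d by linarith
qed

lemma cluster_ball_apart_from_center:
  fixes y w :: "'a::real_inner"
  assumes "norm w = 1" "8 * n < A" "0 < \<rho>" "0 \<le> n"
  shows "cball y (2 * n * \<rho>) \<inter> cball (y + (A * \<rho>) *\<^sub>R w) (2 * n * \<rho>) = {}"
proof (rule ccontr)
  assume "\<not> ?thesis"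
  then obtain x where "dist y x \<le> 2 * n * \<rho>" "dist (y + (A * \<rho>) *\<^sub>R w) x \<le> 2 * n * \<rho>" by auto
  then have d: "dist (y + (A * \<rho>) *\<^sub>R w) y \<le> 2 * n * \<rho> + 2 * n * \<rho>"
    using dist_triangle2[of "y + (A * \<rho>) *\<^sub>R w" y x] by linarith
  have "dist (y + (A * \<rho>) *\<^sub>R w) y = A * \<rho>" using assms by (simp add: dist_norm)
  moreover have "8 * n * \<rho> < A * \<rho>" using assms by (intro mult_strict_right_mono) auto
  moreover have "0 \<le> n * \<rho>" using assms by simp
  ultimately show False using d by linarith
qed

lemma powr_unbounded:
  fixes c e C :: real
  assumes "0 < c" "0 < e"
  obtains N :: nat where "N0 \<le> N" "C < c * real N powr e"
proof -
  define X where "X = (\<bar>C\<bar> + 1) / c"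
  have X: "0 < X" using assms by (simp add: X_def)
  obtain N1 :: nat where N1: "X powr (1 / e) \<le> real N1" using real_arch_simple by blast
  have "X = (X powr (1 / e)) powr e" using X assms by (simp add: powr_powr)
  also have "\<dots> \<le> real (max N0 N1) powr e" using N1 assms by (intro powr_mono2) auto
  finally have "c * X \<le> c * real (max N0 N1) powr e" using assms by (intro mult_left_mono) auto
  moreover have "C < c * X" using assms by (simp add: X_def)
  ultimately show thesis using that[of "max N0 N1"] by simp
qed

text \<open>
  This bounds the loss caused by varying exponents over the \<open>N\<close> scales: only the ratio \<open>2 ^ j\<close> of two scales
  is raised to the small power \<open>e\<close>, and \<open>e\<close> may be chosen after \<open>N\<close>.
\<close>

lemma two_power_powr_le:
  assumes "j < N" "0 \<le> e" "real N * e \<le> 1"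
  shows "((2::real) ^ j) powr e \<le> 2"
proof -
  have "real j * e \<le> real N * e" using assms by (intro mult_right_mono) auto
  then have "real j * e \<le> 1" using assms by linarith
  have "((2::real) ^ j) powr e = 2 powr (real j * e)"
    by (simp add: powr_realpow[symmetric] powr_powr)
  also have "\<dots> \<le> 2 powr 1" using \<open>real j * e \<le> 1\<close> by (intro powr_mono) auto
  finally show ?thesis by simp
qed

lemma exponent_ge_of_recip_less:
  assumes "exponent_function p" "0 < t" "recip_exponent p x < t"
  shows "ereal (1 / t) \<le> p x"
proof -
  have "1 \<le> p x" using assms(1) by (simp add: exponent_function_def)
  then show ?thesis using assms(2,3) unfolding recip_exponent_def
    by (cases "p x") (auto simp: field_simps)
qed

lemma exponent_le_of_less_recip:
  assumes "exponent_function p" "0 < t" "t < recip_exponent p x"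
  shows "p x \<le> ereal (1 / t)"
proof -
  have "1 \<le> p x" using assms(1) by (simp add: exponent_function_def)
  then show ?thesis using assms(2,3) unfolding recip_exponent_def
    by (cases "p x") (auto simp: field_simps)
qed

text \<open>
  The place where the ordering of the exponents enters the first bound: \<open>m \<le> s\<close> and \<open>r \<le> 1\<close> give
  \<open>r powr (n * (m - s)) \<ge> 1\<close>, no matter how small \<open>r\<close> is.
\<close>

lemma powr_lower_near_L1:
  fixes \<rho> r l :: real
  assumes "0 < r" "r \<le> 1" "\<rho> = r * l" "1 \<le> l" "m \<le> s" "0 \<le> n" "l powr (n * s) \<le> 2"
  shows "\<rho> powr (- (n * (\<theta> - s))) / 2 \<le> \<rho> powr (- (n * \<theta>)) * r powr (n * m)"
proof -
  have \<rho>: "0 < \<rho>" using assms by simp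
  have "\<rho> powr (- (n * \<theta>)) = \<rho> powr (- (n * (\<theta> - s))) * \<rho> powr (- (n * s))"
    by (simp add: powr_add[symmetric] algebra_simps)
  moreover have "\<rho> powr (- (n * s)) * r powr (n * m) = r powr (n * (m - s)) * l powr (- (n * s))"
    using assms by (simp add: powr_mult powr_add[symmetric] algebra_simps)
  moreover have "1 / 2 \<le> r powr (n * (m - s)) * l powr (- (n * s))"
  proof -
    have "n * (m - s) \<le> 0" using assms by (simp add: mult_nonneg_nonpos)
    then have "r powr 0 \<le> r powr (n * (m - s))" using assms by (intro powr_mono') auto
    then have "1 \<le> r powr (n * (m - s))" using assms by simp
    moreover have "1 / 2 \<le> l powr (- (n * s))" using assms by (simp add: powr_minus field_simps)
    ultimately show ?thesis using mult_mono[of 1 "r powr (n * (m - s))" "1/2"] by simp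
  qed
  ultimately show ?thesis
    using mult_left_mono[of "1/2" "r powr (n * (m - s)) * l powr (- (n * s))" "\<rho> powr (- (n * (\<theta> - s)))"]
    by (simp add: mult.assoc)
qed

section \<open>The lower bound for the exponent\<close>

text \<open>
  The test function is a multiple of the indicator function of \<open>F\<close>, normalised for the exponent with reciprocal \<open>1 - m\<close>; with
  \<open>s = 1 - 1 / p\<close> this is admissible because \<open>s \<le> m\<close> on \<open>F\<close>. On \<open>U j\<close> one has \<open>s \<ge> m\<close>, so each scale contributes
  to the modular of the image, up to a constant, at least as much as in the case of constant exponent \<open>1\<close>.
\<close>

lemma one_less_p_minus:
  fixes \<alpha> :: real and p q :: "real^'n \<Rightarrow> ereal"
    and K :: "real^'n \<Rightarrow> real^'n \<Rightarrow> 'k::{real_normed_field,euclidean_space}"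
    and T :: "(real^'n \<Rightarrow> 'k) \<Rightarrow> (real^'n \<Rightarrow> 'k)"
  assumes \<alpha>: "0 \<le> \<alpha>" "\<alpha> < real CARD('n)"
    and p: "exponent_function p" and q: "exponent_function q"
    and pq: "AE x in lebesgue. recip_exponent p x - recip_exponent q x = \<alpha> / real CARD('n)"
    and T: "fractional_CZ_operator \<alpha> K T" and nd: "nondegenerate_kernel \<alpha> K"
    and bdd: "bounded_var_Lp p q T"
  shows "1 < p_minus p"
proof (rule ccontr)
  assume pm: "\<not> 1 < p_minus p"
  define n where "n = real CARD('n)"
  have n: "0 < n" "1 \<le> n" by (simp_all add: n_def Suc_le_eq)
  define \<theta> where "\<theta> = 1 - \<alpha> / n"
  have \<theta>: "0 < \<theta>" "\<theta> \<le> 1" using \<alpha> n by (auto simp: \<theta>_def n_def field_simps)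
  have n\<theta>: "\<alpha> - n = - (n * \<theta>)" using n by (simp add: \<theta>_def field_simps)
  have rn: "r powr n = r ^ CARD('n)" if "0 < r" for r :: real
    using that by (simp add: n_def powr_realpow)
  have Kk: "fractional_CZ_kernel \<alpha> K" using T by (simp add: fractional_CZ_operator_def)
  obtain A k u where u: "norm u = 1" and k: "0 < k" and A: "8 * n < A" and
    cone: "\<And>y \<rho> w. 0 < \<rho> \<Longrightarrow> w = u \<or> w = - u \<Longrightarrow> \<exists>\<kappa>. k * \<rho> powr (\<alpha> - n) \<le> norm \<kappa> \<and>
       (\<forall>x\<in>cball (y + (A * \<rho>) *\<^sub>R w) (2 * n * \<rho>). \<forall>z\<in>cball y (2 * n * \<rho>). norm (K x z - \<kappa>) \<le> norm \<kappa> / 4)"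
    by (rule kernel_size_on_cones[OF \<alpha>(2) Kk nd, folded n_def]) (rule that; assumption)
  have A0: "0 \<le> A" using A n by linarith
  obtain C where C: "\<And>f. f \<in> borel_measurable lebesgue \<Longrightarrow> modular p f \<le> 1 \<Longrightarrow> T f \<in> borel_measurable lebesgue"
    "\<And>f c0. f \<in> borel_measurable lebesgue \<Longrightarrow> modular p f \<le> 1 \<Longrightarrow>
      (\<And>c. 0 < c \<Longrightarrow> modular q (\<lambda>x. T f x /\<^sub>R c) \<le> 1 \<Longrightarrow> c0 \<le> c) \<Longrightarrow> c0 \<le> C"
    using bounded_var_Lp_unit_ball[OF bdd] by blast
  define k1 where "k1 = 3 * k / 16"
  have k1: "0 < k1" using k by (simp add: k1_def)
  have key: "(k1 / 2) * (real N / 17) powr (\<theta> / 2) \<le> C" if N: "17 \<le> N" for N :: nat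
  proof -
    define \<epsilon> where "\<epsilon> = min (\<theta> / 2) (1 / (real N * n))"
    have \<epsilon>: "0 < \<epsilon>" "\<epsilon> \<le> \<theta> / 2" "real N * (n * \<epsilon>) \<le> 1"
    proof -
      show "0 < \<epsilon>" "\<epsilon> \<le> \<theta> / 2" using \<theta> n N by (auto simp: \<epsilon>_def)
      have "\<epsilon> \<le> 1 / (real N * n)" by (simp add: \<epsilon>_def)
      then show "real N * (n * \<epsilon>) \<le> 1" using n N by (simp add: field_simps)
    qed
    \<comment> \<open>The second bound on \<open>\<epsilon>\<close> keeps \<open>(2 ^ j) powr (n * \<epsilon>)\<close> below \<open>2\<close> on all scales; the first one keeps the
      exponent \<open>q\<close> at most \<open>2 / \<theta>\<close> on \<open>E\<close>.\<close>
    define E where "E = {x. recip_exponent p x - recip_exponent q x = \<alpha> / n \<and> 1 - \<epsilon> \<le> recip_exponent p x}"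
    have [measurable]: "recip_exponent p \<in> borel_measurable lebesgue" "recip_exponent q \<in> borel_measurable lebesgue"
      using p q by (auto intro: recip_exponent_measurable)
    have "{x \<in> space lebesgue. recip_exponent p x - recip_exponent q x = \<alpha> / n \<and> 1 - \<epsilon> \<le> recip_exponent p x} \<in> sets lebesgue"
      by measurable
    then have El: "E \<in> sets lebesgue" by (simp add: E_def)
    have En: "emeasure lebesgue E \<noteq> 0"
    proof
      assume "emeasure lebesgue E = 0"
      then have "E \<in> null_sets lebesgue" using El by (simp add: null_sets_def del: emeasure_completion)
      then have "AE x in lebesgue. x \<notin> E" by (rule AE_not_in)
      then have "AE x in lebesgue. ereal (1 / (1 - \<epsilon>)) \<le> p x"
        using pq
      proof eventually_elim
        case (elim x)
        then have "recip_exponent p x < 1 - \<epsilon>" by (simp add: E_def n_def)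
        then show ?case using \<epsilon> \<theta> by (intro exponent_ge_of_recip_less[OF p]) auto
      qed
      then have "ereal (1 / (1 - \<epsilon>)) \<le> p_minus p"
        unfolding p_minus_def by (intro Sup_upper) simp
      moreover have "1 < ereal (1 / (1 - \<epsilon>))" using \<epsilon> \<theta> by (simp add: one_ereal_def field_simps)
      ultimately show False using pm by (meson less_le_trans)
    qed
    define s where "s x = 1 - recip_exponent p x" for x
    have s: "s \<in> borel_measurable lebesgue" unfolding s_def[abs_def] by measurable
    have sE: "0 \<le> s x \<and> s x \<le> \<epsilon>" if "x \<in> E" for x
      using that recip_exponent_bounds(2)[OF p, of x] by (auto simp: s_def E_def)
    have qE: "recip_exponent q x = \<theta> - s x" "\<theta> / 2 \<le> recip_exponent q x" if "x \<in> E" for x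
      using that sE[OF that] \<epsilon> by (auto simp: s_def E_def \<theta>_def)
    obtain r y w m F U where fam: "0 < r" "r < 1" "w = u \<or> w = - u" "0 \<le> m" "m \<le> \<epsilon>"
      "F \<in> sets lebesgue" "F \<subseteq> E \<inter> cball y (n * r)" "\<And>x. x \<in> F \<Longrightarrow> s x \<le> m"
      "r ^ CARD('n) / 4 \<le> measure lebesgue F" "measure lebesgue F \<le> r ^ CARD('n)"
      "\<And>j. j < N \<Longrightarrow> U j \<in> sets lebesgue"
      "\<And>j. j < N \<Longrightarrow> U j \<subseteq> E \<inter> cball (y + (A * (r * 2 ^ j)) *\<^sub>R w) (2 * n * (r * 2 ^ j))"
      "\<And>j x. j < N \<Longrightarrow> x \<in> U j \<Longrightarrow> m \<le> s x"
      "\<And>j. j < N \<Longrightarrow> measure lebesgue (U j) \<le> (r * 2 ^ j) ^ CARD('n)"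
      "real N / 16 \<le> (\<Sum>j<N. measure lebesgue (U j) / (r * 2 ^ j) ^ CARD('n))"
      by (rule monotone_cluster_family[where E = E and s = s and \<epsilon> = \<epsilon> and N = N, OF El En s _ u A0 zero_less_one, folded n_def], erule sE) (rule that; assumption)
    note r = fam(1,2)
    have w1: "norm w = 1" using fam(3) u by auto
    define \<rho> where "\<rho> j = r * 2 ^ j" for j :: nat
    have \<rho>: "0 < \<rho> j" "r \<le> \<rho> j" for j using r by (auto simp: \<rho>_def)
    define ball where "ball j = cball (y + (A * \<rho> j) *\<^sub>R w) (2 * n * \<rho> j)" for j
    have Ub: "U j \<subseteq> ball j" "U j \<subseteq> E" if "j < N" for j using fam(12)[OF that] by (auto simp: ball_def \<rho>_def)
    have Ul: "U j \<in> lmeasurable" if "j < N" for j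
      using fam(11)[OF that] Ub(1)[OF that] lmeasurable_cball unfolding ball_def by (blast intro: fmeasurableI2)
    have apart: "U i \<inter> U j = {}" if "i < N" "j < N" "i \<noteq> j" for i j
    proof -
      have *: "ball i \<inter> ball j = {}" if "i < j" for i j
      proof -
        have "(2::real) * 2 ^ i \<le> 2 ^ j" using that by (metis power_Suc power_increasing Suc_leI one_le_numeral)
        then have "2 * \<rho> i \<le> \<rho> j" using r by (simp add: \<rho>_def)
        then show ?thesis unfolding ball_def
          using w1 A \<rho> n by (intro cluster_balls_apart) auto
      qed
      have "ball i \<inter> ball j = {}" using *[of i j] *[of j i] that(3) by (cases "i < j") auto
      then show ?thesis using Ub that by blast
    qed
    have "F \<subseteq> cball y (n * r)" using fam(7) by auto
    define t where "t = r powr (- (n * (1 - m)))"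
    have t0: "0 < t" using r by (simp add: t_def)
    define b :: "nat \<Rightarrow> 'k" where "b j = of_real t" for j
    define f where "f z = (\<Sum>j\<in>{0::nat}. indicator F z *\<^sub>R b j)" for z
    have fm: "f \<in> borel_measurable lebesgue" unfolding f_def
      using fam(6) by (intro borel_measurable_sum borel_measurable_scaleR) auto
    have Fl: "F \<in> lmeasurable" using \<open>F \<subseteq> cball y (n * r)\<close> fam(6) lmeasurable_cball by (blast intro: fmeasurableI2)
    have m1: "m < 1" using fam(5) \<epsilon> \<theta> by linarith
    have modf: "modular p f \<le> 1"
      unfolding f_def
    proof (rule modular_step_le[OF p, where a = "\<lambda>_. r powr (- n)" and B = 0 and U = "\<lambda>_. F"])
      fix j x assume x: "x \<in> F" "0 < recip_exponent p x"
      have "1 - m \<le> recip_exponent p x" using fam(8)[OF x(1)] by (simp add: s_def)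
      then have "(1 - m) / recip_exponent p x \<le> 1" using x(2) by simp
      then have "n * (1 - m) / recip_exponent p x \<le> n" using n(1)
        by (metis mult_left_le less_imp_le times_divide_eq_right)
      then show "norm (b j) powr (1 / recip_exponent p x) \<le> r powr (- n)"
        unfolding b_def t_def using r by (simp add: powr_powr powr_mono')
    next
      fix j x assume x: "x \<in> F" "recip_exponent p x = 0"
      have "1 - m \<le> recip_exponent p x" using fam(8)[OF x(1)] by (simp add: s_def)
      then show "norm (b j) \<le> 0" using x m1 by simp
    next
      have "r powr (- n) * measure lebesgue F \<le> r powr (- n) * r powr n"
        using fam(10) rn[OF r(1)] by (intro mult_left_mono) auto
      then show "(\<Sum>j\<in>{0::nat}. r powr (- n) * measure lebesgue F) + 0 \<le> 1"
        using r by (simp add: powr_add[symmetric])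
    qed (use Fl in auto)
    have Tlow: "AE x in lebesgue. x \<in> U j \<longrightarrow> k1 * \<rho> j powr (- (n * \<theta>)) * r powr (n * m) \<le> norm (T f x)" if j: "j < N" for j
    proof -
      obtain \<kappa> where \<kappa>: "k * \<rho> j powr (\<alpha> - n) \<le> norm \<kappa>"
        "\<And>x z. x \<in> ball j \<Longrightarrow> z \<in> cball y (2 * n * \<rho> j) \<Longrightarrow> norm (K x z - \<kappa>) \<le> norm \<kappa> / 4"
        using cone[OF \<rho>(1)[of j] fam(3), of y] unfolding ball_def by blast
      have sub: "cball y (n * r) \<subseteq> cball y (2 * n * \<rho> j)"
      proof (rule subset_cball)
        show "n * r \<le> 2 * n * \<rho> j" using n \<rho>[of j] mult_left_mono[of r "\<rho> j" n] by (simp add: mult_nonneg_nonneg)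
      qed
      have "AE x in lebesgue. x \<in> U j \<longrightarrow>
          norm (\<Sum>i\<in>{0::nat}. measure lebesgue F *\<^sub>R (\<kappa> * b i)) - (\<Sum>i\<in>{0::nat}. norm \<kappa> * norm (b i) * measure lebesgue F) / 4
          \<le> norm (T (\<lambda>z. \<Sum>i\<in>{0::nat}. indicator F z *\<^sub>R b i) x)"
      proof (rule operator_lower_bound[OF T, where S = "\<lambda>_. cball y (n * r)" and U = "\<lambda>_. F" and \<kappa> = "\<lambda>_. \<kappa>" and X = "U j"])
        fix x assume "x \<in> U j"
        then have x: "x \<in> ball j" using Ub j by blast
        have "cball y (2 * n * \<rho> j) \<inter> ball j = {}"
          unfolding ball_def using w1 A \<rho> n by (intro cluster_ball_apart_from_center) auto
        then show "x \<notin> cball y (n * r)" using x sub by blast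
        show "norm (K x z - \<kappa>) \<le> norm \<kappa> / 4" if "z \<in> cball y (n * r)" for z
          using \<kappa>(2)[OF x] that sub by blast
      qed (use fam(6) \<open>F \<subseteq> cball y (n * r)\<close> in auto)
      then have "AE x in lebesgue. x \<in> U j \<longrightarrow> (3 / 4) * (norm \<kappa> * t * measure lebesgue F) \<le> norm (T f x)"
        using t0 by (simp add: f_def[abs_def] b_def norm_mult mult_ac)
      moreover have "k1 * \<rho> j powr (- (n * \<theta>)) * r powr (n * m) \<le> (3 / 4) * (norm \<kappa> * t * measure lebesgue F)"
      proof -
        have "r powr (n * m) / 4 = t * (r powr n / 4)"
          unfolding t_def by (simp add: powr_add[symmetric] algebra_simps)
        also have "\<dots> \<le> t * measure lebesgue F" using fam(9) t0 rn[OF r(1)] by (intro mult_left_mono) auto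
        finally have "(k * \<rho> j powr (- (n * \<theta>))) * (r powr (n * m) / 4) \<le> norm \<kappa> * (t * measure lebesgue F)"
          using \<kappa>(1) k unfolding n\<theta> by (intro mult_mono) auto
        then show ?thesis by (simp add: k1_def mult_ac)
      qed
      ultimately show ?thesis by (auto elim!: eventually_mono)
    qed
    \<comment> \<open>\<open>\<Lambda>\<close> is chosen such that, for scalings below \<open>\<Lambda>\<close>, the modular is at least \<open>17 / N\<close> times a sum
      that is not below \<open>N / 16\<close>, hence exceeds \<open>1\<close>.\<close>
    define \<Lambda> where "\<Lambda> = (k1 / 2) * (real N / 17) powr (\<theta> / 2)"
    have N17: "1 \<le> real N / 17" using N by simp
    have \<Lambda>: "k1 / 2 \<le> \<Lambda>" "0 < \<Lambda>"
    proof -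
      have "1 \<le> (real N / 17) powr (\<theta> / 2)" using N17 \<theta> by (intro ge_one_powr_ge_zero) auto
      then show "k1 / 2 \<le> \<Lambda>" unfolding \<Lambda>_def using k1 by simp
      then show "0 < \<Lambda>" using k1 by linarith
    qed
    define B where "B = k1 / (2 * \<Lambda>)"
    have B: "0 < B" "B \<le> 1" using \<Lambda> k1 by (auto simp: B_def)
    have BN: "B powr (2 / \<theta>) = 17 / real N"
    proof -
      have "k1 / (2 * (k1 / 2 * X)) = 1 / X" for X using k1 by simp
      then have "B = 1 / (real N / 17) powr (\<theta> / 2)" unfolding B_def \<Lambda>_def by (simp only:)
      then have "B = (real N / 17) powr (- (\<theta> / 2))" by (simp only: powr_minus_divide)
      then have "B powr (2 / \<theta>) = (real N / 17) powr (- 1)" using \<theta> by (simp add: powr_powr)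
      then show ?thesis using N by (simp add: powr_minus)
    qed
    have "\<Lambda> \<le> c" if c: "0 < c" "modular q (\<lambda>x. T f x /\<^sub>R c) \<le> 1" for c
    proof (rule ccontr)
      assume "\<not> \<Lambda> \<le> c"
      then have c\<Lambda>: "c < \<Lambda>" by simp
      have "ennreal (\<Sum>j<N. (17 / real N * \<rho> j powr (- n)) * measure lebesgue (U j)) \<le> modular q (\<lambda>x. T f x /\<^sub>R c)"
      proof (rule modular_ge_sum[OF q])
        fix j assume "j \<in> {..<N}"
        then have j: "j < N" by simp
        show "AE x in lebesgue. x \<in> U j \<longrightarrow> 0 < recip_exponent q x \<and>
            17 / real N * \<rho> j powr (- n) \<le> norm (T f x /\<^sub>R c) powr (1 / recip_exponent q x)"
          using Tlow[OF j]
        proof (rule eventually_mono, intro impI)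
          fix x assume "x \<in> U j \<longrightarrow> k1 * \<rho> j powr (- (n * \<theta>)) * r powr (n * m) \<le> norm (T f x)" and x: "x \<in> U j"
          then have low: "k1 * (\<rho> j powr (- (n * \<theta>)) * r powr (n * m)) \<le> norm (T f x)" by simp
          have xE: "x \<in> E" using x Ub j by blast
          let ?\<sigma> = "recip_exponent q x"
          have \<sigma>: "?\<sigma> = \<theta> - s x" "0 < ?\<sigma>" "\<theta> / 2 \<le> ?\<sigma>" using qE[OF xE] \<theta> by auto
          have l2: "((2::real) ^ j) powr (n * s x) \<le> 2"
          proof (rule two_power_powr_le[OF j])
            show "0 \<le> n * s x" using n sE[OF xE] by simp
            have "real N * (n * s x) \<le> real N * (n * \<epsilon>)" using n sE[OF xE] by (intro mult_left_mono) auto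
            then show "real N * (n * s x) \<le> 1" using \<epsilon>(3) by linarith
          qed
          have "\<rho> j powr (- (n * ?\<sigma>)) / 2 \<le> \<rho> j powr (- (n * \<theta>)) * r powr (n * m)"
            unfolding \<sigma>(1) using r n fam(13)[OF j x] l2
            by (intro powr_lower_near_L1[where l = "2 ^ j"]) (auto simp: \<rho>_def)
          then have "k1 * (\<rho> j powr (- (n * ?\<sigma>)) / 2) \<le> norm (T f x)"
            using low k1 by (meson mult_left_mono less_imp_le order.trans)
          then have "k1 * (\<rho> j powr (- (n * ?\<sigma>)) / 2) / \<Lambda> \<le> norm (T f x) / c"
            using c c\<Lambda> k1 by (intro frac_le) auto
          then have v: "B * \<rho> j powr (- (n * ?\<sigma>)) \<le> norm (T f x /\<^sub>R c)"
          proof -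
            have "norm (T f x /\<^sub>R c) = norm (T f x) / c" using c by (simp add: divide_inverse_commute)
            moreover have "k1 * (Y / 2) / \<Lambda> = B * Y" for Y by (simp add: B_def)
            ultimately show ?thesis
              using \<open>k1 * (\<rho> j powr (- (n * ?\<sigma>)) / 2) / \<Lambda> \<le> norm (T f x) / c\<close> by (simp only:)
          qed
          have "17 / real N * \<rho> j powr (- n) \<le> B powr (1 / ?\<sigma>) * \<rho> j powr (- n)"
            unfolding BN[symmetric] using B \<sigma> \<theta>
            by (intro mult_right_mono powr_mono') (auto simp: field_simps)
          also have "\<dots> = (B * \<rho> j powr (- (n * ?\<sigma>))) powr (1 / ?\<sigma>)"
            using B \<rho> \<sigma> by (simp add: powr_mult powr_powr)
          also have "\<dots> \<le> norm (T f x /\<^sub>R c) powr (1 / ?\<sigma>)"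
            using v B \<sigma> by (intro powr_mono2) auto
          finally show "0 < ?\<sigma> \<and> 17 / real N * \<rho> j powr (- n) \<le> norm (T f x /\<^sub>R c) powr (1 / ?\<sigma>)"
            using \<sigma> by simp
        qed
      qed (use Ul apart in auto)
      then have "ennreal (\<Sum>j<N. (17 / real N * \<rho> j powr (- n)) * measure lebesgue (U j)) \<le> 1" using c(2) by (rule order.trans)
      then have "(\<Sum>j<N. (17 / real N * \<rho> j powr (- n)) * measure lebesgue (U j)) \<le> 1" by simp
      moreover have "(\<Sum>j<N. (17 / real N * \<rho> j powr (- n)) * measure lebesgue (U j))
          = 17 / real N * (\<Sum>j<N. measure lebesgue (U j) / (r * 2 ^ j) ^ CARD('n))"
      proof -
        have "\<rho> j powr (- n) = 1 / (r * 2 ^ j) ^ CARD('n)" for j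
          using rn[OF \<rho>(1)] by (simp add: powr_minus \<rho>_def divide_inverse)
        then show ?thesis by (simp add: sum_distrib_left)
      qed
      moreover have "17 / real N * (real N / 16) \<le> 17 / real N * (\<Sum>j<N. measure lebesgue (U j) / (r * 2 ^ j) ^ CARD('n))"
        using fam(15) by (intro mult_left_mono) auto
      moreover have "17 / real N * (real N / 16) = 17 / 16" using N by simp
      ultimately show False by linarith
    qed
    then show ?thesis unfolding \<Lambda>_def[symmetric] by (intro C(2)[OF fm modf]) auto
  qed
  obtain N where N: "17 \<le> N" "C < (k1 / 2) * (1 / 17) powr (\<theta> / 2) * real N powr (\<theta> / 2)"
    using powr_unbounded[of "(k1 / 2) * (1 / 17) powr (\<theta> / 2)" "\<theta> / 2" 17 C] k1 \<theta> by auto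
  have "(real N / 17) powr (\<theta> / 2) = (1 / 17) powr (\<theta> / 2) * real N powr (\<theta> / 2)"
    by (simp add: powr_mult[symmetric])
  then show False using key[OF N(1)] N(2) by (simp add: mult.assoc)
qed

section \<open>The upper bound for the exponent and the theorem\<close>

text \<open>
  Dual to the previous lemma: now the source is the union of the sets \<open>U j\<close>, the target is \<open>F\<close>, and \<open>s = 1 / q\<close>. The values
  on \<open>U j\<close> have size \<open>\<rho> powr (- (\<alpha> + n * m))\<close>, up to a common factor, and a phase cancelling that of the kernel, so the contributions of all
  scales add up on \<open>F\<close>. The modular stays bounded after division by \<open>N\<close> to a power just above \<open>\<alpha> / n\<close>, and the sum over the scales
  gains a full factor \<open>N\<close>.
\<close>

lemma p_plus_less:
  fixes \<alpha> :: real and p q :: "real^'n \<Rightarrow> ereal"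
    and K :: "real^'n \<Rightarrow> real^'n \<Rightarrow> 'k::{real_normed_field,euclidean_space}"
    and T :: "(real^'n \<Rightarrow> 'k) \<Rightarrow> (real^'n \<Rightarrow> 'k)"
  assumes \<alpha>: "0 \<le> \<alpha>" "\<alpha> < real CARD('n)"
    and p: "exponent_function p" and q: "exponent_function q"
    and pq: "AE x in lebesgue. recip_exponent p x - recip_exponent q x = \<alpha> / real CARD('n)"
    and T: "fractional_CZ_operator \<alpha> K T" and nd: "nondegenerate_kernel \<alpha> K"
    and bdd: "bounded_var_Lp p q T"
  shows "p_plus p < ereal (real CARD('n)) / ereal \<alpha>"
proof (rule ccontr)
  assume pp: "\<not> p_plus p < ereal (real CARD('n)) / ereal \<alpha>"
  define n where "n = real CARD('n)"
  have n: "0 < n" "1 \<le> n" by (simp_all add: n_def Suc_le_eq)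
  define a where "a = \<alpha> / n"
  have a: "0 \<le> a" "a < 1" using \<alpha> n by (auto simp: a_def n_def field_simps)
  have na: "\<alpha> - n = - (n * (1 - a))" using n by (simp add: a_def field_simps)
  have rn: "r powr n = r ^ CARD('n)" if "0 < r" for r :: real
    using that by (simp add: n_def powr_realpow)
  have Kk: "fractional_CZ_kernel \<alpha> K" using T by (simp add: fractional_CZ_operator_def)
  obtain A k u where u: "norm u = 1" and k: "0 < k" and A: "8 * n < A" and
    cone: "\<And>y \<rho> w. 0 < \<rho> \<Longrightarrow> w = u \<or> w = - u \<Longrightarrow> \<exists>\<kappa>. k * \<rho> powr (\<alpha> - n) \<le> norm \<kappa> \<and>
       (\<forall>x\<in>cball (y + (A * \<rho>) *\<^sub>R w) (2 * n * \<rho>). \<forall>z\<in>cball y (2 * n * \<rho>). norm (K x z - \<kappa>) \<le> norm \<kappa> / 4)"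
    by (rule kernel_size_on_cones[OF \<alpha>(2) Kk nd, folded n_def]) (rule that; assumption)
  have A0: "0 \<le> A" using A n by linarith
  obtain C where C: "\<And>f. f \<in> borel_measurable lebesgue \<Longrightarrow> modular p f \<le> 1 \<Longrightarrow> T f \<in> borel_measurable lebesgue"
    "\<And>f c0. f \<in> borel_measurable lebesgue \<Longrightarrow> modular p f \<le> 1 \<Longrightarrow>
      (\<And>c. 0 < c \<Longrightarrow> modular q (\<lambda>x. T f x /\<^sub>R c) \<le> 1 \<Longrightarrow> c0 \<le> c) \<Longrightarrow> c0 \<le> C"
    using bounded_var_Lp_unit_ball[OF bdd] by blast
  have key: "(3 * k / 1024) * real N powr ((1 - a) / 2) \<le> C" if N: "1 \<le> N" for N :: nat
  proof -
    define \<epsilon> where "\<epsilon> = min ((1 - a) / 2) (1 / (real N * n))"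
    have \<epsilon>: "0 < \<epsilon>" "\<epsilon> \<le> (1 - a) / 2" "real N * (n * \<epsilon>) \<le> 1"
    proof -
      show "0 < \<epsilon>" using a n N by (auto simp: \<epsilon>_def)
      show "\<epsilon> \<le> (1 - a) / 2" unfolding \<epsilon>_def by (rule min.cobounded1)
      have "\<epsilon> \<le> 1 / (real N * n)" by (simp add: \<epsilon>_def)
      then show "real N * (n * \<epsilon>) \<le> 1" using n N by (simp add: field_simps)
    qed
    \<comment> \<open>The first bound on \<open>\<epsilon>\<close> saves a power \<open>N powr ((1 - a) / 2)\<close> in the end; the second one keeps
      \<open>(2 ^ j) powr (n * \<epsilon>)\<close> below \<open>2\<close> on all scales.\<close>
    define E where "E = {x. recip_exponent p x - recip_exponent q x = a \<and> recip_exponent q x \<le> \<epsilon>}"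
    have [measurable]: "recip_exponent p \<in> borel_measurable lebesgue" "recip_exponent q \<in> borel_measurable lebesgue"
      using p q by (auto intro: recip_exponent_measurable)
    have "{x \<in> space lebesgue. recip_exponent p x - recip_exponent q x = a \<and> recip_exponent q x \<le> \<epsilon>} \<in> sets lebesgue"
      by measurable
    then have El: "E \<in> sets lebesgue" by (simp add: E_def)
    have En: "emeasure lebesgue E \<noteq> 0"
    proof
      assume "emeasure lebesgue E = 0"
      then have "E \<in> null_sets lebesgue" using El by (simp add: null_sets_def del: emeasure_completion)
      then have "AE x in lebesgue. x \<notin> E" by (rule AE_not_in)
      then have "AE x in lebesgue. p x \<le> ereal (1 / (a + \<epsilon>))"
        using pq
      proof eventually_elim
        case (elim x)
        then have "a + \<epsilon> < recip_exponent p x" by (auto simp: E_def a_def n_def)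
        then show ?case using \<epsilon> a by (intro exponent_le_of_less_recip[OF p]) auto
      qed
      moreover have "p \<in> borel_measurable lebesgue" using p by (simp add: exponent_function_def)
      ultimately have "p_plus p \<le> ereal (1 / (a + \<epsilon>))"
        unfolding p_plus_def by (intro esssup_I)
      also have "\<dots> < ereal n / ereal \<alpha>"
      proof (cases "\<alpha> = 0")
        case True
        then show ?thesis using n by (simp add: divide_ereal_def)
      next
        case False
        then have "0 < a" using \<alpha> n by (simp add: a_def)
        moreover have "n / \<alpha> = 1 / a" using n by (simp add: a_def)
        ultimately show ?thesis using False \<epsilon> by (simp add: divide_strict_left_mono)
      qed
      finally show False using pp by (simp add: n_def)
    qed
    define s where "s x = recip_exponent q x" for x
    have s: "s \<in> borel_measurable lebesgue" unfolding s_def[abs_def] by measurable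
    have sE: "0 \<le> s x \<and> s x \<le> \<epsilon>" if "x \<in> E" for x
      using that recip_exponent_bounds(1)[OF q, of x] by (auto simp: s_def E_def)
    have pE: "recip_exponent p x = a + s x" if "x \<in> E" for x
      using that by (auto simp: s_def E_def)
    have R0: "0 < 1 / (2::real) ^ N" by simp
    obtain r y w m F U where fam: "0 < r" "r < 1 / 2 ^ N" "w = u \<or> w = - u" "0 \<le> m" "m \<le> \<epsilon>"
      "F \<in> sets lebesgue" "F \<subseteq> E \<inter> cball y (n * r)" "\<And>x. x \<in> F \<Longrightarrow> s x \<le> m"
      "r ^ CARD('n) / 4 \<le> measure lebesgue F" "measure lebesgue F \<le> r ^ CARD('n)"
      "\<And>j. j < N \<Longrightarrow> U j \<in> sets lebesgue"
      "\<And>j. j < N \<Longrightarrow> U j \<subseteq> E \<inter> cball (y + (A * (r * 2 ^ j)) *\<^sub>R w) (2 * n * (r * 2 ^ j))"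
      "\<And>j x. j < N \<Longrightarrow> x \<in> U j \<Longrightarrow> m \<le> s x"
      "\<And>j. j < N \<Longrightarrow> measure lebesgue (U j) \<le> (r * 2 ^ j) ^ CARD('n)"
      "real N / 16 \<le> (\<Sum>j<N. measure lebesgue (U j) / (r * 2 ^ j) ^ CARD('n))"
      by (rule monotone_cluster_family[where E = E and s = s and \<epsilon> = \<epsilon> and N = N, OF El En s _ u A0 R0, folded n_def], erule sE) (rule that; assumption)
    have "1 / 2 ^ N \<le> (1::real)" by simp
    then have r: "0 < r" "r \<le> 1" using fam(1,2) by linarith+
    have w1: "norm w = 1" using fam(3) u by auto
    define \<rho> where "\<rho> j = r * 2 ^ j" for j :: nat
    have \<rho>: "0 < \<rho> j" "r \<le> \<rho> j" for j using r by (auto simp: \<rho>_def)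
    have \<rho>1: "\<rho> j \<le> 1" if "j < N" for j
    proof -
      have "r * 2 ^ j \<le> r * 2 ^ N" using r that by (intro mult_left_mono power_increasing) auto
      also have "\<dots> \<le> 1" using fam(2) by (simp add: field_simps)
      finally show ?thesis by (simp add: \<rho>_def)
    qed
    define ball where "ball j = cball (y + (A * \<rho> j) *\<^sub>R w) (2 * n * \<rho> j)" for j
    have Ub: "U j \<subseteq> ball j" "U j \<subseteq> E" if "j < N" for j using fam(12)[OF that] by (auto simp: ball_def \<rho>_def)
    have Ul: "U j \<in> lmeasurable" if "j < N" for j
      using fam(11)[OF that] Ub(1)[OF that] lmeasurable_cball unfolding ball_def by (blast intro: fmeasurableI2)
    have apart: "U i \<inter> U j = {}" if "i < N" "j < N" "i \<noteq> j" for i j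
    proof -
      have *: "ball i \<inter> ball j = {}" if "i < j" for i j
      proof -
        have "(2::real) ^ Suc i \<le> 2 ^ j" using that by (intro power_increasing) auto
        then have "2 * \<rho> i \<le> \<rho> j" using r by (simp add: \<rho>_def)
        then show ?thesis unfolding ball_def
          using w1 A \<rho> n by (intro cluster_balls_apart) auto
      qed
      have "ball i \<inter> ball j = {}" using *[of i j] *[of j i] that(3) by (cases "i < j") auto
      then show ?thesis using Ub that by blast
    qed
    have Fy: "F \<subseteq> cball y (n * r)" using fam(7) by auto
    have Fl: "F \<in> lmeasurable" using Fy fam(6) lmeasurable_cball by (blast intro: fmeasurableI2)
    have "\<exists>\<kappa>. k * \<rho> j powr (\<alpha> - n) \<le> norm \<kappa> \<and>
        (\<forall>x\<in>cball y (2 * n * \<rho> j). \<forall>z\<in>ball j. norm (K x z - \<kappa>) \<le> norm \<kappa> / 4)" for j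
    proof -
      \<comment> \<open>The cone is seen from the distant centre, hence in the opposite direction.\<close>
      have "- w = u \<or> - w = - u" using fam(3) by auto
      from cone[OF \<rho>(1)[of j] this, of "y + (A * \<rho> j) *\<^sub>R w"] show ?thesis by (simp add: ball_def)
    qed
    then have "\<forall>j. \<exists>\<kappa>. k * \<rho> j powr (\<alpha> - n) \<le> norm \<kappa> \<and>
        (\<forall>x\<in>cball y (2 * n * \<rho> j). \<forall>z\<in>ball j. norm (K x z - \<kappa>) \<le> norm \<kappa> / 4)" ..
    from choice[OF this] obtain \<kappa> where \<kappa>': "\<forall>j. k * \<rho> j powr (\<alpha> - n) \<le> norm (\<kappa> j) \<and>
        (\<forall>x\<in>cball y (2 * n * \<rho> j). \<forall>z\<in>ball j. norm (K x z - \<kappa> j) \<le> norm (\<kappa> j) / 4)" ..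
    have \<kappa>: "k * \<rho> j powr (\<alpha> - n) \<le> norm (\<kappa> j)"
      "x \<in> cball y (2 * n * \<rho> j) \<Longrightarrow> z \<in> ball j \<Longrightarrow> norm (K x z - \<kappa> j) \<le> norm (\<kappa> j) / 4" for j x z
      using \<kappa>' by blast+
    have \<kappa>0: "\<kappa> j \<noteq> 0" for j
    proof -
      have "0 < k * \<rho> j powr (\<alpha> - n)" using k \<rho>[of j] by simp
      then show ?thesis using \<kappa>(1)[of j] by auto
    qed
    \<comment> \<open>The factor \<open>1 / 2\<close> leaves half of the modular for the points with infinite exponent, which occur for \<open>\<alpha> = 0\<close>.\<close>
    define t where "t j = (1 / 2) * real N powr (- (a + \<epsilon>)) * \<rho> j powr (- (n * (a + m)))" for j
    have t0: "0 < t j" for j using N \<rho>[of j] by (simp add: t_def)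
    \<comment> \<open>The unit factor turns \<open>\<kappa> j * b j\<close> into a positive real number.\<close>
    define b :: "nat \<Rightarrow> 'k" where "b j = t j *\<^sub>R (of_real (norm (\<kappa> j)) / \<kappa> j)" for j
    have nb: "norm (b j) = t j" for j
      using \<kappa>0[of j] t0[of j] by (simp add: b_def norm_divide)
    have \<kappa>b: "\<kappa> j * b j = of_real (norm (\<kappa> j) * t j)" for j
      using \<kappa>0[of j] by (simp add: b_def scaleR_conv_of_real)
    define f where "f z = (\<Sum>j<N. indicator (U j) z *\<^sub>R b j)" for z
    have fm: "f \<in> borel_measurable lebesgue" unfolding f_def
      using fam(11) by (intro borel_measurable_sum borel_measurable_scaleR) auto
    have \<rho>n: "\<rho> j powr (- n) = 1 / (r * 2 ^ j) ^ CARD('n)" for j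
      using rn[OF \<rho>(1)] by (simp add: powr_minus \<rho>_def divide_inverse)
    have modf: "modular p f \<le> 1"
      unfolding f_def
    proof (rule modular_step_le[OF p, where a = "\<lambda>j. 1 / (2 * real N) * \<rho> j powr (- n)" and B = "1 / 2"])
      fix j x assume "j \<in> {..<N}" and x: "x \<in> U j" "0 < recip_exponent p x"
      then have j: "j < N" by simp
      let ?\<sigma> = "recip_exponent p x"
      have \<sigma>: "?\<sigma> = a + s x" "?\<sigma> \<le> 1" "m \<le> s x" "s x \<le> \<epsilon>"
        using pE[of x] sE[of x] recip_exponent_bounds(2)[OF p, of x] Ub(2)[OF j] fam(13)[OF j x(1)] x(1) by auto
      have "t j powr (1 / ?\<sigma>) = (1 / 2) powr (1 / ?\<sigma>) * real N powr (- ((a + \<epsilon>) / ?\<sigma>)) * \<rho> j powr (- (n * ((a + m) / ?\<sigma>)))"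
      proof -
        have prod: "(v1 * v2 * v3) powr e = v1 powr e * v2 powr e * v3 powr e"
          if "0 \<le> v1" "0 \<le> v2" "0 \<le> v3" for v1 v2 v3 e :: real
          using that by (simp add: powr_mult)
        have pp: "(v powr - e) powr (1 / ?\<sigma>) = v powr - (e / ?\<sigma>)" for v e :: real
          by (simp add: powr_powr)
        have "t j powr (1 / ?\<sigma>) = (1 / 2) powr (1 / ?\<sigma>) * (real N powr - (a + \<epsilon>)) powr (1 / ?\<sigma>)
            * (\<rho> j powr - (n * (a + m))) powr (1 / ?\<sigma>)"
          unfolding t_def by (rule prod) simp_all
        then show ?thesis by (simp only: pp times_divide_eq_right)
      qed
      also have "\<dots> \<le> (1 / 2) powr 1 * real N powr (- 1) * \<rho> j powr (- n)"
      proof (intro mult_mono)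
        show "(1 / 2 :: real) powr (1 / ?\<sigma>) \<le> (1 / 2) powr 1"
          using \<sigma> x by (intro powr_mono') auto
        show "real N powr (- ((a + \<epsilon>) / ?\<sigma>)) \<le> real N powr (- 1)"
          using \<sigma> x N by (intro powr_mono) auto
        have "n * ((a + m) / ?\<sigma>) \<le> n" using \<sigma> x n by (intro mult_left_le) auto
        then show "\<rho> j powr (- (n * ((a + m) / ?\<sigma>))) \<le> \<rho> j powr (- n)"
          using \<rho>1[OF j] \<rho>[of j] by (intro powr_mono') auto
      qed auto
      also have "\<dots> = 1 / (2 * real N) * \<rho> j powr (- n)"
      proof -
        have "real N powr (- 1) = 1 / real N" using N powr_minus_divide[of "real N" 1] by simp
        moreover have "(1 / 2 :: real) powr 1 = 1 / 2" by simp
        moreover have "1 / 2 * (1 / real N) = 1 / (2 * real N)" by simp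
        ultimately show ?thesis by (simp only:)
      qed
      finally show "norm (b j) powr (1 / ?\<sigma>) \<le> 1 / (2 * real N) * \<rho> j powr (- n)" by (simp add: nb)
    next
      fix j x assume "j \<in> {..<N}" and x: "x \<in> U j" "recip_exponent p x = 0"
      then have j: "j < N" by simp
      have "a + s x = 0" "m \<le> s x" "0 \<le> s x"
        using pE[of x] sE[of x] Ub(2)[OF j] fam(13)[OF j x(1)] x by auto
      then have "a + m = 0" using a fam(4) by linarith
      moreover have "\<rho> j powr (- (n * 0)) = 1" using \<rho>(1)[of j] by simp
      ultimately have "t j = (1 / 2) * real N powr (- (a + \<epsilon>))" unfolding t_def by (simp only: mult_1_right)
      also have "\<dots> \<le> (1 / 2) * real N powr 0" using N a \<epsilon> by (intro mult_left_mono powr_mono) auto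
      finally show "norm (b j) \<le> 1 / 2" using N by (simp add: nb)
    next
      have "(\<Sum>j<N. 1 / (2 * real N) * \<rho> j powr (- n) * measure lebesgue (U j)) \<le> (\<Sum>j<N. 1 / (2 * real N))"
      proof (rule sum_mono)
        fix j assume "j \<in> {..<N}"
        then have "\<rho> j powr (- n) * measure lebesgue (U j) \<le> \<rho> j powr (- n) * \<rho> j powr n"
          using fam(14)[of j] rn[OF \<rho>(1)[of j]] by (intro mult_left_mono) (auto simp: \<rho>_def)
        also have "\<dots> = 1" using \<rho>[of j] by (simp add: powr_add[symmetric])
        finally have "1 / (2 * real N) * (\<rho> j powr (- n) * measure lebesgue (U j)) \<le> 1 / (2 * real N) * 1"
          by (rule mult_left_mono) simp
        then show "1 / (2 * real N) * \<rho> j powr (- n) * measure lebesgue (U j) \<le> 1 / (2 * real N)"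
          by (simp only: mult.assoc mult_1_right)
      qed
      also have "\<dots> = 1 / 2" using N by simp
      finally show "(\<Sum>j<N. 1 / (2 * real N) * \<rho> j powr (- n) * measure lebesgue (U j)) + 1 / 2 \<le> 1" by simp
    qed (use Ul apart in auto)
    define H where "H = (3 * k / 256) * real N powr (1 - (a + \<epsilon>)) * r powr (- (n * m))"
    have H0: "0 \<le> H" using k by (simp add: H_def)
    have Tlow: "AE x in lebesgue. x \<in> F \<longrightarrow> H \<le> norm (T f x)"
    proof -
      have "AE x in lebesgue. x \<in> F \<longrightarrow>
          norm (\<Sum>j<N. measure lebesgue (U j) *\<^sub>R (\<kappa> j * b j)) - (\<Sum>j<N. norm (\<kappa> j) * norm (b j) * measure lebesgue (U j)) / 4
          \<le> norm (T (\<lambda>z. \<Sum>j<N. indicator (U j) z *\<^sub>R b j) x)"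
      proof (rule operator_lower_bound[OF T, where S = ball])
        fix x j assume x: "x \<in> F"
        have "n * r \<le> 2 * n * \<rho> j" using n \<rho>[of j] mult_left_mono[of r "\<rho> j" n] by (simp add: mult_nonneg_nonneg)
        then have xb: "x \<in> cball y (2 * n * \<rho> j)" using x Fy by auto
        have "cball y (2 * n * \<rho> j) \<inter> ball j = {}"
          unfolding ball_def using w1 A \<rho> n by (intro cluster_ball_apart_from_center) auto
        then show "x \<notin> ball j" using xb by blast
        show "norm (K x z - \<kappa> j) \<le> norm (\<kappa> j) / 4" if "z \<in> ball j" for z
          using \<kappa>(2)[OF xb that] .
      qed (use fam(11) Ub in \<open>auto simp: ball_def\<close>)
      moreover have "H \<le> norm (\<Sum>j<N. measure lebesgue (U j) *\<^sub>R (\<kappa> j * b j)) - (\<Sum>j<N. norm (\<kappa> j) * norm (b j) * measure lebesgue (U j)) / 4"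
      proof -
        define Z where "Z = (\<Sum>j<N. norm (\<kappa> j) * t j * measure lebesgue (U j))"
        have Z0: "0 \<le> Z" unfolding Z_def using t0 by (intro sum_nonneg mult_nonneg_nonneg) (auto intro: less_imp_le)
        have "(\<Sum>j<N. measure lebesgue (U j) *\<^sub>R (\<kappa> j * b j)) = of_real Z"
          unfolding Z_def \<kappa>b by (simp add: scaleR_conv_of_real mult.commute)
        then have "norm (\<Sum>j<N. measure lebesgue (U j) *\<^sub>R (\<kappa> j * b j)) = Z" using Z0 by simp
        moreover have "(\<Sum>j<N. norm (\<kappa> j) * norm (b j) * measure lebesgue (U j)) = Z" by (simp add: Z_def nb)
        moreover have "H \<le> (3 / 4) * Z"
        proof -
          define D where "D = (k / 4) * real N powr (- (a + \<epsilon>)) * r powr (- (n * m))"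
          have D0: "0 \<le> D" using k by (simp add: D_def)
          have "D * (real N / 16) \<le> D * (\<Sum>j<N. measure lebesgue (U j) / (r * 2 ^ j) ^ CARD('n))"
            using fam(15) D0 by (rule mult_left_mono)
          also have "\<dots> = (\<Sum>j<N. D * \<rho> j powr (- n) * measure lebesgue (U j))"
            by (simp add: \<rho>n sum_distrib_left)
          also have "\<dots> \<le> Z" unfolding Z_def
          proof (intro sum_mono mult_right_mono)
            fix j assume "j \<in> {..<N}"
            then have j: "j < N" by simp
            have "((2::real) ^ j) powr (n * m) \<le> 2"
            proof (rule two_power_powr_le[OF j])
              show "0 \<le> n * m" using n fam(4) by simp
              have "real N * (n * m) \<le> real N * (n * \<epsilon>)" using n fam(5) by (intro mult_left_mono) auto
              then show "real N * (n * m) \<le> 1" using \<epsilon>(3) by linarith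
            qed
            then have "1 / 2 \<le> ((2::real) ^ j) powr (- (n * m))" by (simp add: powr_minus field_simps)
            then have "r powr (- (n * m)) * (1 / 2) \<le> r powr (- (n * m)) * (2 ^ j) powr (- (n * m))"
              by (intro mult_left_mono) auto
            also have "\<dots> = \<rho> j powr (- (n * m))" using r by (simp add: \<rho>_def powr_mult)
            finally have *: "r powr (- (n * m)) / 2 \<le> \<rho> j powr (- (n * m))" by simp
            have "D * \<rho> j powr (- n) = (k / 2) * real N powr (- (a + \<epsilon>)) * \<rho> j powr (- n) * (r powr (- (n * m)) / 2)"
              by (simp add: D_def)
            also have "\<dots> \<le> (k / 2) * real N powr (- (a + \<epsilon>)) * \<rho> j powr (- n) * \<rho> j powr (- (n * m))"
              using * k by (intro mult_left_mono) auto
            also have "\<dots> = (k * \<rho> j powr (\<alpha> - n)) * t j"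
              unfolding t_def na by (simp add: powr_add[symmetric] algebra_simps)
            also have "\<dots> \<le> norm (\<kappa> j) * t j" using \<kappa>(1) t0 by (intro mult_right_mono) (auto intro: less_imp_le)
            finally show "D * \<rho> j powr (- n) \<le> norm (\<kappa> j) * t j" .
          qed auto
          finally have DZ: "D * (real N / 16) \<le> Z" .
          have "real N powr (1 - (a + \<epsilon>)) = real N * real N powr (- (a + \<epsilon>))"
            using N powr_add[of "real N" 1 "- (a + \<epsilon>)"] by (simp add: diff_conv_add_uminus del: minus_add_distrib add_uminus_conv_diff)
          then have "H = (3 / 4) * (D * (real N / 16))"
            by (simp add: H_def D_def)
          then show ?thesis using DZ by simp
        qed
        ultimately show ?thesis by linarith
      qed
      ultimately show ?thesis unfolding f_def[abs_def] by (auto elim!: eventually_mono)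
    qed
    have rpos: "0 < r ^ CARD('n)" "r ^ CARD('n) \<le> 1" using r by (auto simp: power_le_one)
    have "H * measure lebesgue F powr m \<le> C"
    proof (rule C(2)[OF fm modf])
      fix c :: real assume c: "0 < c" "modular q (\<lambda>x. T f x /\<^sub>R c) \<le> 1"
      show "H * measure lebesgue F powr m \<le> c"
      proof (rule norm_ge_on_set[OF q C(1)[OF fm modf] Fl _ _ fam(4) _ H0 Tlow c])
        show "0 < measure lebesgue F" "measure lebesgue F \<le> 1" using fam(9,10) rpos by linarith+
        show "recip_exponent q x \<le> m" if "x \<in> F" for x using fam(8)[OF that] by (simp add: s_def)
      qed
    qed
    moreover have "(3 * k / 1024) * real N powr ((1 - a) / 2) \<le> H * measure lebesgue F powr m"
    proof -
      have "(1 - a) / 2 \<le> 1" using a by simp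
      then have m1: "m \<le> 1" using fam(5) \<epsilon>(2) by (meson order.trans)
      have "r powr (n * m) * (1 / 4) \<le> r powr (n * m) * (1 / 4) powr m"
        using m1 powr_mono'[of m 1 "1/4"] by (intro mult_left_mono) auto
      also have "\<dots> = (r ^ CARD('n) / 4) powr m"
        using r rn[OF r(1), symmetric] by (simp add: powr_mult powr_divide powr_powr)
      also have "\<dots> \<le> measure lebesgue F powr m" using fam(4,9) rpos by (intro powr_mono2) auto
      finally have Fm: "r powr (n * m) * (1 / 4) \<le> measure lebesgue F powr m" .
      have "(3 * k / 1024) * real N powr ((1 - a) / 2) \<le> (3 * k / 1024) * real N powr (1 - (a + \<epsilon>))"
        using N k \<epsilon> by (intro mult_left_mono powr_mono) (auto simp: field_simps)
      also have "\<dots> = H * (r powr (n * m) * (1 / 4))"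
        using r by (simp add: H_def powr_minus)
      also have "\<dots> \<le> H * measure lebesgue F powr m" using Fm H0 by (rule mult_left_mono)
      finally show ?thesis .
    qed
    ultimately show ?thesis by linarith
  qed
  obtain N where N: "1 \<le> N" "C < (3 * k / 1024) * real N powr ((1 - a) / 2)"
    using powr_unbounded[of "3 * k / 1024" "(1 - a) / 2" 1 C] k a by auto
  then show False using key[OF N(1)] by simp
qed

theorem theorem1p3:
  fixes \<alpha> :: real
    and p q :: "real^'n \<Rightarrow> ereal"
    and K :: "real^'n \<Rightarrow> real^'n \<Rightarrow> 'k::{real_normed_field,euclidean_space}"
    and T :: "(real^'n \<Rightarrow> 'k) \<Rightarrow> (real^'n \<Rightarrow> 'k)"
  assumes "0 \<le> \<alpha>" and "\<alpha> < real CARD('n)"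
    and "exponent_function p"
    and "p_plus p \<le> ereal (real CARD('n)) / ereal \<alpha>"
    and "exponent_function q"
    and "AE x in lebesgue. 1 / p x - 1 / q x = ereal (\<alpha> / real CARD('n))"
    and "fractional_CZ_operator \<alpha> K T"
    and "nondegenerate_kernel \<alpha> K"
    and "bounded_var_Lp p q T"
  shows "1 < p_minus p \<and> p_minus p \<le> p_plus p \<and>
         p_plus p < ereal (real CARD('n)) / ereal \<alpha>"
proof (intro conjI)
  have pq: "AE x in lebesgue. recip_exponent p x - recip_exponent q x = \<alpha> / real CARD('n)"
    using assms(6) by (rule eventually_mono) (rule recip_exponent_diff[OF assms(3,5)])
  show "1 < p_minus p"
    by (rule one_less_p_minus[OF assms(1,2,3,5) pq assms(7,8,9)])
  show "p_plus p < ereal (real CARD('n)) / ereal \<alpha>"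
    by (rule p_plus_less[OF assms(1,2,3,5) pq assms(7,8,9)])
  show "p_minus p \<le> p_plus p"
    unfolding p_minus_def
  proof (rule Sup_least)
    fix c assume "c \<in> {c. AE x in lebesgue. c \<le> p x}"
    then have "AE x in lebesgue. c \<le> p x" by simp
    moreover have "AE x in lebesgue. p x \<le> p_plus p"
      unfolding p_plus_def by (rule esssup_AE)
    ultimately have "AE x in (lebesgue :: (real^'n) measure). c \<le> p_plus p"
      by eventually_elim (rule order.trans)
    moreover have "ae_filter (lebesgue :: (real^'n) measure) \<noteq> bot"
      by (simp add: ae_filter_eq_bot_iff)
    ultimately show "c \<le> p_plus p" by (simp add: eventually_const)
  qed
qed

end
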